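(* Let $\mathcal{R}^*$ be a read collection closed under reverse complement (defined in the context), let $k\ge 3$ be the order, $m$ the minimum overlap parameter, and let $M$ be the BOSS matrix of order $k$ of $\mathcal{R}^*$. Using the VO-BOSS index of $\mathcal{R}^*$ (BOSS index plus the LCS array stored in a wavelet tree), there is an algorithm that, given a node $v$ (a row of $M$), computes $\texttt{nextcontained}(v)$ in $\mathcal{O}(k^2\log\sigma)$ time, where $\sigma$ is the alphabet size.
   Context: DNA alphabet $\Sigma=\{\texttt{a},\texttt{c},\texttt{g},\texttt{t}\}$, mapped to $[2..\sigma]$, plus a dummy symbol $\$$ mapped to $1$ (the smallest symbol). The complement $\pi$ exchanges $\texttt{a}\leftrightarrow\texttt{t}$ and $\texttt{c}\leftrightarrow\texttt{g}$; the reverse complement $R^{rc}$ of a string $R$ reverses $R$ and replaces each symbol by its complement. $\mathcal{R}=\{R_1,\dots,R_r\}$ is a set of reads of equal length $z$ and $\mathcal{R}^*=\mathcal{R}\cup\{R_i^{rc}\}$. De Bruijn graph of order $k$: nodes are the distinct substrings of length $k-1$ of strings of $\mathcal{R}^*$ (solid nodes), and there is an edge labeled $b$ from $w$ to $w'$ when $wb$ is a length-$k$ substring of some string of $\mathcal{R}^*$ and $w'=(wb)[2..k]$. In addition, for each prefix $X$ of length $d<k-1$ of a string of $\mathcal{R}^*$ there is a linker node $\$^{k-1-d}X$, with $\texttt{llabel}(\$^{k-1-d}X)=X$; linker $\$^{k-1-d}X$ has an outgoing edge labeled $b$ if $Xb$ is a prefix of a string of $\mathcal{R}^*$. The BOSS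 matrix $M$ has one row per (solid or linker) node, each a string of length $k-1$, sorted in colexicographic order (lexicographic order of the reversed strings). The BOSS index stores the outgoing edge symbols of the rows concatenated in row order in a sequence $E$ (in a wavelet tree), a bitmap $B$ marking the last outgoing symbol of each row, and an array $C[1..\sigma]$ where $C[i]$ is the number of rows whose last symbol is smaller than $i$. The VO-BOSS index additionally stores the array $LCS$, where $LCS[i]$ is the length of the longest common suffix of rows $i-1$ and $i$ of $M$, in a wavelet tree. A linker node $v'$ is contained in a node $v$ if $\texttt{llabel}(v')$ is a suffix of $v$ (for a linker $v$, of $\texttt{llabel}(v)$). For a node $v$ and parameter $m$, $\texttt{nextcontained}(v)$ returns the greatest (in the order of $M$, equivalently the one with longest $\texttt{llabel}$) linker node $v'\ne v$ contained in $v$ such that $\texttt{llabel}(v')$ is a proper suffix of the non-$\$$ part of $v$ and has length at least $m$; if no such linker exists, it returns a dummy value. *)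

theory Defs
  imports
    Complex_Main
    "HOL-Library.Sublist"
    "HOL-Library.List_Lexorder"
    "HOL-Library.Log_Nat"
begin

text \<open>
  Symbols are natural numbers: the dummy \<open>$\<close> is \<open>1\<close> and the proper symbols are \<open>2..\<sigma>\<close>.
  The alphabet size \<open>\<sigma>\<close> and the complement are parameters, so that a bound in \<open>log \<sigma>\<close> has
  content; DNA is the instance \<open>\<sigma> = 5\<close> with \<open>dna_complement\<close>.
\<close>

type_synonym str = "nat list"

abbreviation (input) dollar :: nat where "dollar \<equiv> 1"

definition complement_map :: "nat \<Rightarrow> (nat \<Rightarrow> nat) \<Rightarrow> bool" where
  "complement_map \<sigma> \<pi> \<longleftrightarrow> (\<forall>x\<in>{2..\<sigma>}. \<pi> x \<in> {2..\<sigma>} \<and> \<pi> (\<pi> x) = x)"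

text \<open>\<open>a, c, g, t\<close> are \<open>2, 3, 4, 5\<close>.\<close>

definition dna_complement :: "nat \<Rightarrow> nat" where
  "dna_complement = id(2 := 5, 5 := 2, 3 := 4, 4 := 3)"

lemma complement_map_dna: "complement_map 5 dna_complement"
  by (auto simp: complement_map_def dna_complement_def)

definition read_set :: "nat \<Rightarrow> nat \<Rightarrow> str set \<Rightarrow> bool" where
  "read_set \<sigma> z R \<longleftrightarrow> finite R \<and> (\<forall>s\<in>R. length s = z \<and> set s \<subseteq> {2..\<sigma>})"

definition revcomp :: "(nat \<Rightarrow> nat) \<Rightarrow> str \<Rightarrow> str" where
  "revcomp \<pi> s = rev (map \<pi> s)"

definition rc_closure :: "(nat \<Rightarrow> nat) \<Rightarrow> str set \<Rightarrow> str set" where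
  "rc_closure \<pi> R = R \<union> revcomp \<pi> ` R"


section \<open>De Bruijn graph and BOSS matrix\<close>

definition solid_nodes :: "nat \<Rightarrow> str set \<Rightarrow> str set" where
  "solid_nodes k S = {w. length w = k - 1 \<and> (\<exists>s\<in>S. sublist w s)}"

definition linker_nodes :: "nat \<Rightarrow> str set \<Rightarrow> str set" where
  "linker_nodes k S =
     {replicate (k - 1 - length X) dollar @ X | X. length X < k - 1 \<and> (\<exists>s\<in>S. prefix X s)}"

definition nodes :: "nat \<Rightarrow> str set \<Rightarrow> str set" where
  "nodes k S = solid_nodes k S \<union> linker_nodes k S"

text \<open>
  The non-\<open>$\<close> part of a node: on a linker \<open>$\<^sup>jX\<close> this is \<open>X\<close>, on a solid node the identity
  (reads contain no \<open>$\<close>).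
\<close>

definition llabel :: "str \<Rightarrow> str" where
  "llabel w = dropWhile (\<lambda>x. x = dollar) w"

definition out_symbols :: "nat \<Rightarrow> str set \<Rightarrow> str \<Rightarrow> nat set" where
  "out_symbols k S w =
     {b. (w \<in> solid_nodes k S \<and> (\<exists>s\<in>S. sublist (w @ [b]) s)) \<or>
         (w \<in> linker_nodes k S \<and> (\<exists>s\<in>S. prefix (llabel w @ [b]) s))}"

definition edge_target :: "str \<Rightarrow> nat \<Rightarrow> str" where
  "edge_target w b = tl (w @ [b])"

text \<open>Colexicographic order: the order on lists is the lexicographic one of List-Lexorder.\<close>

definition boss_matrix :: "nat \<Rightarrow> str set \<Rightarrow> str list" where
  "boss_matrix k S = map rev (sorted_list_of_set (rev ` nodes k S))"

definition num_rows :: "nat \<Rightarrow> str set \<Rightarrow> nat" where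
  "num_rows k S = length (boss_matrix k S)"

text \<open>Rows are numbered from \<open>1\<close>.\<close>

definition row :: "nat \<Rightarrow> str set \<Rightarrow> nat \<Rightarrow> str" where
  "row k S i = boss_matrix k S ! (i - 1)"

definition contained :: "str \<Rightarrow> str \<Rightarrow> bool" where
  "contained v' v \<longleftrightarrow> suffix (llabel v') (llabel v)"

definition contained_linkers :: "nat \<Rightarrow> nat \<Rightarrow> str set \<Rightarrow> nat \<Rightarrow> nat set" where
  "contained_linkers k m S v =
     {i \<in> {1..num_rows k S}. i \<noteq> v \<and> row k S i \<in> linker_nodes k S \<and>
        contained (row k S i) (row k S v) \<and>
        strict_suffix (llabel (row k S i)) (llabel (row k S v)) \<and>
        m \<le> length (llabel (row k S i))}"

text \<open>Nodes are given by their row number; \<open>0\<close> is the dummy value.\<close>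

definition nextcontained :: "nat \<Rightarrow> nat \<Rightarrow> str set \<Rightarrow> nat \<Rightarrow> nat" where
  "nextcontained k m S v =
     (if contained_linkers k m S v = {} then 0 else Max (contained_linkers k m S v))"


section \<open>Wavelet trees and the VO-BOSS index\<close>

text \<open>\<open>wavelet h xs\<close> is the balanced wavelet tree of a sequence of \<open>h\<close>-bit numbers.\<close>

datatype wtree = WLeaf | WNode "bool list" wtree wtree

fun wavelet :: "nat \<Rightarrow> nat list \<Rightarrow> wtree" where
  "wavelet 0 xs = WLeaf"
| "wavelet (Suc h) xs =
     WNode (map (\<lambda>x. bit x h) xs)
       (wavelet h (filter (\<lambda>x. \<not> bit x h) xs))
       (wavelet h (filter (\<lambda>x. bit x h) xs))"

text \<open>Tree nodes have heap addresses: the root is \<open>1\<close>, the children of \<open>a\<close> are \<open>2a\<close> and \<open>2a + 1\<close>.\<close>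

fun wsubtree :: "wtree \<Rightarrow> nat \<Rightarrow> wtree" where
  "wsubtree t a =
     (if a \<le> 1 then t
      else (case wsubtree t (a div 2) of
              WLeaf \<Rightarrow> WLeaf
            | WNode _ l r \<Rightarrow> (if even a then l else r)))"

declare wsubtree.simps [simp del]

definition wbitmap :: "wtree \<Rightarrow> nat \<Rightarrow> bool list" where
  "wbitmap t a = (case wsubtree t a of WLeaf \<Rightarrow> [] | WNode bs _ _ \<Rightarrow> bs)"

text \<open>A row without outgoing edge is represented in \<open>E\<close> by the single symbol \<open>$\<close>.\<close>

definition out_list :: "nat \<Rightarrow> str set \<Rightarrow> str \<Rightarrow> nat list" where
  "out_list k S w =
     (if out_symbols k S w = {} then [dollar] else sorted_list_of_set (out_symbols k S w))"

text \<open>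
  In the sequence \<open>E\<close> of a BOSS index (Bowe, Onodera, Sadakane, Shibuya) an edge symbol is flagged
  if the target of the edge is already reached from an earlier row; without the flags, rank and
  select on \<open>E\<close> do not navigate the graph. The flagged version of \<open>b\<close> is \<open>b + \<sigma>\<close>.
\<close>

definition flagged :: "nat \<Rightarrow> str set \<Rightarrow> nat \<Rightarrow> nat \<Rightarrow> bool" where
  "flagged k S i b \<longleftrightarrow>
     b \<in> out_symbols k S (row k S i) \<and>
     (\<exists>i'\<in>{1..<i}. b \<in> out_symbols k S (row k S i') \<and>
        edge_target (row k S i') b = edge_target (row k S i) b)"

definition E_seq :: "nat \<Rightarrow> nat \<Rightarrow> str set \<Rightarrow> nat list" where
  "E_seq \<sigma> k S =
     concat (map (\<lambda>i. map (\<lambda>b. if flagged k S i b then b + \<sigma> else b) (out_list k S (row k S i)))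
       [1..<Suc (num_rows k S)])"

definition B_bitmap :: "nat \<Rightarrow> str set \<Rightarrow> bool list" where
  "B_bitmap k S =
     concat (map (\<lambda>w. replicate (length (out_list k S w) - 1) False @ [True]) (boss_matrix k S))"

definition C_array :: "nat \<Rightarrow> nat \<Rightarrow> str set \<Rightarrow> nat list" where
  "C_array \<sigma> k S = map (\<lambda>a. card {i \<in> {1..num_rows k S}. last (row k S i) < a}) [1..<Suc \<sigma>]"

definition lcsuf :: "str \<Rightarrow> str \<Rightarrow> nat" where
  "lcsuf u w = Max {length x | x. suffix x u \<and> suffix x w}"

definition LCS_seq :: "nat \<Rightarrow> str set \<Rightarrow> nat list" where
  "LCS_seq k S =
     map (\<lambda>i. if i = 1 then 0 else lcsuf (row k S (i - 1)) (row k S i)) [1..<Suc (num_rows k S)]"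

text \<open>\<open>E\<close> has symbols in \<open>1..2\<sigma>\<close>, \<open>LCS\<close> has entries below \<open>k\<close>.\<close>

definition E_height :: "nat \<Rightarrow> nat" where
  "E_height \<sigma> = ceillog2 (2 * \<sigma> + 1)"

definition LCS_height :: "nat \<Rightarrow> nat" where
  "LCS_height k = ceillog2 k"

record vo_boss =
  E_tree :: wtree
  B_bits :: "bool list"
  C_vals :: "nat list"
  LCS_tree :: wtree

definition vo_boss_index :: "nat \<Rightarrow> nat \<Rightarrow> str set \<Rightarrow> vo_boss" where
  "vo_boss_index \<sigma> k S =
     \<lparr> E_tree = wavelet (E_height \<sigma>) (E_seq \<sigma> k S),
       B_bits = B_bitmap k S,
       C_vals = C_array \<sigma> k S,
       LCS_tree = wavelet (LCS_height k) (LCS_seq k S) \<rparr>"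


section \<open>Word RAM with a read-only index\<close>

text \<open>
  Bitmap positions are numbered from \<open>1\<close>. Out-of-range accesses and selections yield \<open>0\<close>.
\<close>

definition bm_access :: "bool list \<Rightarrow> nat \<Rightarrow> nat" where
  "bm_access bs i = (if 1 \<le> i \<and> i \<le> length bs \<and> bs ! (i - 1) then 1 else 0)"

definition bm_rank :: "bool \<Rightarrow> bool list \<Rightarrow> nat \<Rightarrow> nat" where
  "bm_rank b bs i = count_list (take i bs) b"

definition bm_select :: "bool \<Rightarrow> bool list \<Rightarrow> nat \<Rightarrow> nat" where
  "bm_select b bs j =
     (if 1 \<le> j \<and> j \<le> count_list bs b then (LEAST i. bm_rank b bs i = j) else 0)"

datatype bitmap_ref = InE | InLCS | InB

text \<open>The address \<open>a\<close> of a wavelet tree node is irrelevant for \<open>B\<close>.\<close>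

fun ref_bitmap :: "vo_boss \<Rightarrow> bitmap_ref \<Rightarrow> nat \<Rightarrow> bool list" where
  "ref_bitmap I InE a = wbitmap (E_tree I) a"
| "ref_bitmap I InLCS a = wbitmap (LCS_tree I) a"
| "ref_bitmap I InB a = B_bits I"

datatype arith = Add | Sub | Mul | Div

fun arith_val :: "arith \<Rightarrow> nat \<Rightarrow> nat \<Rightarrow> nat" where
  "arith_val Add x y = x + y"
| "arith_val Sub x y = x - y"
| "arith_val Mul x y = x * y"
| "arith_val Div x y = x div y"

text \<open>
  Operands are addresses of memory cells, except for the literal of \<open>Const\<close>. All instructions
  take unit time; the bitmaps are assumed to come with constant-time access, rank and select.
  Operations on whole wavelet trees are not primitive.
\<close>

datatype instr =
    Const nat
  | Arith arith nat nat
  | Load nat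
  | ReadC nat
  | Access bitmap_ref nat nat
  | Rank bool bitmap_ref nat nat
  | Select bool bitmap_ref nat nat

type_synonym mem = "nat \<Rightarrow> nat"

fun instr_val :: "vo_boss \<Rightarrow> instr \<Rightarrow> mem \<Rightarrow> nat" where
  "instr_val I (Const c) s = c"
| "instr_val I (Arith f x y) s = arith_val f (s x) (s y)"
| "instr_val I (Load x) s = s (s x)"
| "instr_val I (ReadC x) s =
     (if 1 \<le> s x \<and> s x \<le> length (C_vals I) then C_vals I ! (s x - 1) else 0)"
| "instr_val I (Access r a x) s = bm_access (ref_bitmap I r (s a)) (s x)"
| "instr_val I (Rank b r a x) s = bm_rank b (ref_bitmap I r (s a)) (s x)"
| "instr_val I (Select b r a x) s = bm_select b (ref_bitmap I r (s a)) (s x)"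

datatype test = Less nat nat | Equal nat nat

fun test_val :: "test \<Rightarrow> mem \<Rightarrow> bool" where
  "test_val (Less x y) s \<longleftrightarrow> s x < s y"
| "test_val (Equal x y) s \<longleftrightarrow> s x = s y"

datatype com =
    Skip
  | Assign nat instr
  | Store nat nat
  | Seq com com
  | If test com com
  | While test com

text \<open>
  \<open>exec I W p s t s'\<close>: program \<open>p\<close> with index \<open>I\<close>, started in memory \<open>s\<close>, halts in memory \<open>s'\<close>
  after \<open>t\<close> time units. Machine words hold the numbers below \<open>W\<close>; an assignment of a number
  that does not fit is stuck. \<open>Store x y\<close> writes to the cell whose address is in cell \<open>x\<close>.
\<close>

inductive exec :: "vo_boss \<Rightarrow> nat \<Rightarrow> com \<Rightarrow> mem \<Rightarrow> nat \<Rightarrow> mem \<Rightarrow> bool" for I W where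
  Skip: "exec I W Skip s 1 s"
| Assign: "instr_val I e s < W \<Longrightarrow> exec I W (Assign x e) s 1 (s(x := instr_val I e s))"
| Store: "exec I W (Store x y) s 1 (s(s x := s y))"
| Seq: "exec I W p s t s' \<Longrightarrow> exec I W q s' t' s'' \<Longrightarrow> exec I W (Seq p q) s (t + t') s''"
| IfTrue: "test_val b s \<Longrightarrow> exec I W p s t s' \<Longrightarrow> exec I W (If b p q) s (1 + t) s'"
| IfFalse: "\<not> test_val b s \<Longrightarrow> exec I W q s t s' \<Longrightarrow> exec I W (If b p q) s (1 + t) s'"
| WhileFalse: "\<not> test_val b s \<Longrightarrow> exec I W (While b p) s 1 s"
| WhileTrue: "test_val b s \<Longrightarrow> exec I W p s t s' \<Longrightarrow> exec I W (While b p) s' t' s'' \<Longrightarrow>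
    exec I W (While b p) s (1 + t + t') s''"

inductive_cases exec_cases:
  "exec I W Skip s t s'"
  "exec I W (Assign x e) s t s'"
  "exec I W (Store x y) s t s'"
  "exec I W (Seq p q) s t s'"
  "exec I W (If b p q) s t s'"
  "exec I W (While b p) s t s'"

lemma exec_deterministic:
  "exec I W p s t s' \<Longrightarrow> exec I W p s u s'' \<Longrightarrow> t = u \<and> s' = s''"
proof (induction arbitrary: u s'' rule: exec.induct)
  case (Seq p s t s' q t' s3)
  from Seq.prems show ?case by (cases rule: exec.cases) (use Seq.IH in blast)+
next
  case (WhileTrue b s p t s' t' s3)
  from WhileTrue.prems WhileTrue.hyps show ?case
    by (cases rule: exec.cases) (use WhileTrue.IH in blast)+
next
  case (IfTrue b s p t s' q)
  from IfTrue.prems IfTrue.hyps show ?case by (cases rule: exec.cases) (use IfTrue.IH in blast)+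
next
  case (IfFalse b s q t s' p)
  from IfFalse.prems IfFalse.hyps show ?case by (cases rule: exec.cases) (use IfFalse.IH in blast)+
qed (auto elim: exec_cases)

text \<open>
  The input occupies cells \<open>0..7\<close>: the row \<open>v\<close>, the threshold \<open>m\<close>, and the dimensions of the index.
\<close>

definition input_list :: "nat \<Rightarrow> nat \<Rightarrow> nat \<Rightarrow> str set \<Rightarrow> nat \<Rightarrow> nat list" where
  "input_list \<sigma> k m S v =
     [v, m, k, \<sigma>, num_rows k S, length (E_seq \<sigma> k S), E_height \<sigma>, LCS_height k]"

definition initial_mem :: "nat list \<Rightarrow> mem" where
  "initial_mem xs a = (if a < length xs then xs ! a else 0)"

end

theory Submission
  imports Defs
begin

text \<open>
  The non-\<open>$\<close> part \<open>X\<close> of row \<open>v\<close> is read off from right to left by at most \<open>k - 1\<close> backward steps.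
  Then, for every proper suffix of \<open>X\<close> of length at least \<open>m\<close>, one walks forward from the root
  \<open>$\<close>-row along that suffix: the walk runs through linkers and succeeds exactly if the suffix is a
  prefix of a read, in which case it ends in the linker with this label. The largest row found is the
  answer. These are \<open>O(k\<^sup>2)\<close> steps, and each is a rank or a select on the wavelet tree of \<open>E\<close> and a
  search in \<open>C\<close>, hence takes time \<open>O(log \<sigma>)\<close>. The steps are correct because the unflagged edges
  labelled \<open>b\<close>, in row order, lead to the rows ending in \<open>b\<close>, in row order.
\<close>

section \<open>Rank and select on wavelet trees\<close>

lemma bm_rank_0 [simp]: "bm_rank b bs 0 = 0"
  by (simp add: bm_rank_def)

lemma bm_rank_mono: "i \<le> j \<Longrightarrow> bm_rank b bs i \<le> bm_rank b bs j"
  by (metis bm_rank_def count_list_append le_Suc_ex le_add1 take_add)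

lemma bm_rank_Suc: "i < length bs \<Longrightarrow> bm_rank b bs (Suc i) = bm_rank b bs i + (if bs ! i = b then 1 else 0)"
  by (simp add: bm_rank_def take_Suc_conv_app_nth)

lemma bm_rank_le_count: "bm_rank b bs i \<le> count_list bs b"
  unfolding bm_rank_def by (metis append_take_drop_id count_list_append le_add1)

lemma bm_select_0 [simp]: "bm_select b bs 0 = 0"
  by (simp add: bm_select_def)

lemma bm_select_rank:
  assumes "i < length bs" "bs ! i = b"
  shows "bm_select b bs (bm_rank b bs (Suc i)) = Suc i"
proof -
  have pos: "1 \<le> bm_rank b bs (Suc i)" using assms by (simp add: bm_rank_Suc)
  have "(LEAST j. bm_rank b bs j = bm_rank b bs (Suc i)) = Suc i"
  proof (rule Least_equality)
    fix j assume j: "bm_rank b bs j = bm_rank b bs (Suc i)"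
    show "Suc i \<le> j"
    proof (rule ccontr)
      assume "\<not> Suc i \<le> j"
      then have "bm_rank b bs j \<le> bm_rank b bs i" by (intro bm_rank_mono) simp
      then show False using j assms by (simp add: bm_rank_Suc)
    qed
  qed simp
  then show ?thesis using pos bm_rank_le_count[of b bs "Suc i"] by (simp add: bm_select_def)
qed

lemma take_length_filter_take: "take (length (filter P (take p xs))) (filter P xs) = filter P (take p xs)"
  by (metis append_eq_conv_conj append_take_drop_id filter_append)

lemma odd_div_iff:
  fixes y q :: nat
  shows "y div 2 = q div 2 \<and> (odd y \<longleftrightarrow> odd q) \<longleftrightarrow> y = q"
  by (metis div_mult_mod_eq parity_cases)

lemma bit_add_power_iff:
  fixes x :: nat assumes "e < h"
  shows "bit x e \<longleftrightarrow> odd ((2 ^ h + x) div 2 ^ e)"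
proof -
  have "(2::nat) ^ h = 2 ^ e * (2 * 2 ^ (h - Suc e))"
    using assms by (metis Suc_leI add_Suc_right le_add_diff_inverse2 power_Suc power_add mult.commute add.commute)
  then have "(2 ^ h + x) div 2 ^ e = 2 * 2 ^ (h - Suc e) + x div 2 ^ e"
    by (simp add: div_mult_self3)
  then show ?thesis by (simp add: bit_iff_odd)
qed

lemma address_bit_iff:
  fixes x :: nat assumes "e < h"
  shows "(2 ^ h + x) div 2 ^ Suc e = a div 2 \<and> (bit x e \<longleftrightarrow> odd a) \<longleftrightarrow> (2 ^ h + x) div 2 ^ e = a"
proof -
  have "(2 ^ h + x) div 2 ^ Suc e = (2 ^ h + x) div 2 ^ e div 2"
    by (metis div_mult2_eq mult.commute power_Suc)
  then show ?thesis unfolding bit_add_power_iff[OF assms] by (simp only: odd_div_iff)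
qed

text \<open>
  An element \<open>x\<close> of the sequence sits at the leaf with heap address \<open>2 ^ h + x\<close>, so the tree node
  above \<open>x\<close> whose subtree has height \<open>e\<close> has address \<open>(2 ^ h + x) div 2 ^ e\<close>.
\<close>

lemma wsubtree_wavelet:
  assumes "\<forall>x\<in>set xs. x < 2 ^ h" "l \<le> h" "a div 2 ^ l = 1"
  shows "wsubtree (wavelet h xs) a =
    wavelet (h - l) (filter (\<lambda>x. (2 ^ h + x) div 2 ^ (h - l) = a) xs)"
  using assms(2,3)
proof (induction l arbitrary: a)
  case 0
  then have "a = 1" by simp
  moreover have "(2 ^ h + x) div 2 ^ h = 1" if "x \<in> set xs" for x
    using assms(1) that by (simp add: div_eq_dividend_iff)
  then have "filter (\<lambda>x. (2 ^ h + x) div 2 ^ h = 1) xs = xs"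
    by (simp add: filter_id_conv)
  ultimately show ?case by (simp add: wsubtree.simps)
next
  case (Suc l)
  have a: "a div 2 div 2 ^ l = 1" using Suc.prems by (simp add: div_mult2_eq)
  then have "\<not> a \<le> 1"
    by (metis One_nat_def bot_nat_0.extremum_uniqueI div_0 div_less le_Suc_eq lessI numeral_2_eq_2 zero_neq_one)
  define e where "e = h - Suc l"
  have e: "h - l = Suc e" "e < h" using Suc.prems by (auto simp: e_def)
  let ?F = "filter (\<lambda>x. (2 ^ h + x) div 2 ^ Suc e = a div 2) xs"
  have IH: "wsubtree (wavelet h xs) (a div 2) = wavelet (Suc e) ?F"
    using Suc.IH[of "a div 2"] Suc.prems(1) a e by simp
  have "wsubtree (wavelet h xs) a = wavelet e (filter (\<lambda>x. bit x e \<longleftrightarrow> odd a) ?F)"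
    using \<open>\<not> a \<le> 1\<close> by (subst wsubtree.simps) (simp add: IH)
  also have "filter (\<lambda>x. bit x e \<longleftrightarrow> odd a) ?F = filter (\<lambda>x. (2 ^ h + x) div 2 ^ e = a) xs"
    by (simp only: filter_filter address_bit_iff[OF e(2)])
  finally show ?case by (simp add: e_def)
qed

lemma count_list_map: "count_list (map f xs) y = length (filter (\<lambda>x. f x = y) xs)"
  by (induction xs) auto

text \<open>Where position \<open>p\<close> of \<open>xs\<close> is mapped to in the tree node of height \<open>e\<close> above the leaf of \<open>b\<close>.\<close>

definition wpos :: "nat \<Rightarrow> nat list \<Rightarrow> nat \<Rightarrow> nat \<Rightarrow> nat \<Rightarrow> nat" where
  "wpos h xs b e p = length (filter (\<lambda>x. (2 ^ h + x) div 2 ^ e = (2 ^ h + b) div 2 ^ e) (take p xs))"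

lemma wpos_le: "wpos h xs b e p \<le> p"
  unfolding wpos_def by (metis length_filter_le length_take le_trans min.cobounded2)

lemma wpos_leaf: "wpos h xs b 0 p = count_list (take p xs) b"
  using count_list_map[of id "take p xs" b] by (simp add: wpos_def)

lemma wpos_root:
  assumes "\<forall>x\<in>set xs. x < 2 ^ h" "b < 2 ^ h" "p \<le> length xs"
  shows "wpos h xs b h p = p"
proof -
  have "(2 ^ h + x) div 2 ^ h = 1" if "x < 2 ^ h" for x :: nat
    using that by simp
  then have "filter (\<lambda>x. (2 ^ h + x) div 2 ^ h = (2 ^ h + b) div 2 ^ h) (take p xs) = take p xs"
    using assms by (intro filter_True) (auto dest!: in_set_takeD)
  then show ?thesis using assms by (simp add: wpos_def)
qed

lemma wbitmap_wavelet:
  assumes "\<forall>x\<in>set xs. x < 2 ^ h" "b < 2 ^ h" "e < h"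
  shows "wbitmap (wavelet h xs) ((2 ^ h + b) div 2 ^ Suc e) =
    map (\<lambda>x. bit x e) (filter (\<lambda>x. (2 ^ h + x) div 2 ^ Suc e = (2 ^ h + b) div 2 ^ Suc e) xs)"
proof -
  have "(2 ^ h + b) div 2 ^ Suc e div 2 ^ (h - Suc e) = (2 ^ h + b) div 2 ^ h"
    by (metis Suc_leI add.commute assms(3) div_mult2_eq le_add_diff_inverse2 power_add)
  also have "\<dots> = 1" using assms(2) by simp
  finally have *: "(2 ^ h + b) div 2 ^ Suc e div 2 ^ (h - Suc e) = 1" .
  have "h - (h - Suc e) = Suc e" using assms(3) by simp
  then show ?thesis
    using wsubtree_wavelet[OF assms(1) diff_le_self *] by (simp add: wbitmap_def)
qed

lemma wpos_rank:
  assumes "\<forall>x\<in>set xs. x < 2 ^ h" "b < 2 ^ h" "e < h"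
  shows "bm_rank (odd ((2 ^ h + b) div 2 ^ e)) (wbitmap (wavelet h xs) ((2 ^ h + b) div 2 ^ Suc e))
    (wpos h xs b (Suc e) p) = wpos h xs b e p"
proof -
  have "(2 ^ h + b) div 2 ^ Suc e = (2 ^ h + b) div 2 ^ e div 2"
    by (metis div_mult2_eq mult.commute power_Suc)
  note F = address_bit_iff[OF assms(3), of _ "(2 ^ h + b) div 2 ^ e", folded this]
  show ?thesis
    unfolding bm_rank_def wbitmap_wavelet[OF assms] take_map count_list_map
    unfolding wpos_def take_length_filter_take filter_filter F ..
qed

lemma wpos_select:
  assumes "\<forall>x\<in>set xs. x < 2 ^ h" "e < h" "i < length xs" "xs ! i = b"
  shows "bm_select (odd ((2 ^ h + b) div 2 ^ e)) (wbitmap (wavelet h xs) ((2 ^ h + b) div 2 ^ Suc e))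
    (wpos h xs b e (Suc i)) = wpos h xs b (Suc e) (Suc i)"
proof -
  have b: "b < 2 ^ h" using assms by auto
  define P where "P = (\<lambda>x. (2 ^ h + x) div 2 ^ Suc e = (2 ^ h + b) div 2 ^ Suc e)"
  let ?bs = "wbitmap (wavelet h xs) ((2 ^ h + b) div 2 ^ Suc e)"
  define j where "j = length (filter P (take i xs))"
  have Pb: "P b" by (simp add: P_def)
  have "xs = take i xs @ b # drop (Suc i) xs" using assms(3,4) id_take_nth_drop by blast
  then have f: "filter P xs = filter P (take i xs) @ b # filter P (drop (Suc i) xs)"
    by (metis (full_types) Pb filter.simps(2) filter_append)
  have bs: "?bs = map (\<lambda>x. bit x e) (filter P xs)"
    unfolding P_def by (rule wbitmap_wavelet[OF assms(1) b assms(2)])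
  have "j < length ?bs" unfolding bs f by (simp add: j_def)
  moreover have "?bs ! j = bit b e" unfolding bs f by (simp add: j_def nth_append)
  moreover have "wpos h xs b (Suc e) (Suc i) = Suc j"
    using Pb by (simp add: wpos_def P_def j_def take_Suc_conv_app_nth assms(3,4))
  ultimately show ?thesis
    using bm_select_rank[of j ?bs "bit b e"] wpos_rank[OF assms(1) b assms(2), of "Suc i"]
    by (simp add: bit_add_power_iff[OF assms(2)])
qed

section \<open>The BOSS matrix\<close>

lemma butlast_mono:
  fixes u u' :: "'a::linorder list"
  shows "length u = length u' \<Longrightarrow> u \<le> u' \<Longrightarrow> butlast u \<le> butlast u'"
  by (induction u u' rule: list_induct2) auto

lemma edge_target_eq: "w \<noteq> [] \<Longrightarrow> edge_target w b = tl w @ [b]"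
  by (simp add: edge_target_def)

lemma count_list_take_mono: "i \<le> j \<Longrightarrow> count_list (take i xs) x \<le> count_list (take j xs) x"
  by (metis count_list_append le_Suc_ex le_add1 take_add)

lemma take_concat_blocks:
  assumes "i \<le> n"
  shows "take (length (concat (map f [1..<Suc i]))) (concat (map f [1..<Suc n])) = concat (map f [1..<Suc i])"
proof -
  have "[1..<Suc n] = [1..<Suc i] @ [Suc i..<Suc n]"
    using assms by (metis Suc_le_mono add.commute le_Suc_ex le_add1 plus_1_eq_Suc upt_add_eq_append)
  then show ?thesis by simp
qed

lemma concat_blocks_Suc: "concat (map f [1..<Suc (Suc i)]) = concat (map f [1..<Suc i]) @ f (Suc i)"
  by simp

definition linker :: "nat \<Rightarrow> str \<Rightarrow> str" where
  "linker k X = replicate (k - 1 - length X) dollar @ X"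

locale boss =
  fixes \<sigma> k :: nat and S :: "str set"
  assumes finite_S: "finite S"
    and S_nonempty: "S \<noteq> {}"
    and symbols: "s \<in> S \<Longrightarrow> set s \<subseteq> {2..\<sigma>}"
    and k_ge: "3 \<le> k"
    and sigma_ge: "2 \<le> \<sigma>"
begin

abbreviation "N \<equiv> num_rows k S"
abbreviation "rw \<equiv> row k S"
abbreviation "out \<equiv> out_symbols k S"

definition is_prefix :: "str \<Rightarrow> bool" where
  "is_prefix X \<longleftrightarrow> (\<exists>s\<in>S. prefix X s)"

lemma is_prefix_symbols: "is_prefix X \<Longrightarrow> set X \<subseteq> {2..\<sigma>}"
  unfolding is_prefix_def using symbols set_mono_prefix by blast

lemma is_prefix_snocD: "is_prefix (X @ [b]) \<Longrightarrow> is_prefix X"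
  unfolding is_prefix_def by (meson append_prefixD)

lemma is_prefix_Nil: "is_prefix []"
  using S_nonempty by (auto simp: is_prefix_def)

lemma linker_nodes_iff: "w \<in> linker_nodes k S \<longleftrightarrow> (\<exists>X. w = linker k X \<and> length X < k - 1 \<and> is_prefix X)"
  by (auto simp: linker_nodes_def linker_def is_prefix_def)

lemma solid_symbols: "w \<in> solid_nodes k S \<Longrightarrow> set w \<subseteq> {2..\<sigma>}"
  unfolding solid_nodes_def using symbols set_mono_sublist by blast

lemma length_linker: "length X < k - 1 \<Longrightarrow> length (linker k X) = k - 1"
  by (simp add: linker_def)

lemma hd_linker: "length X < k - 1 \<Longrightarrow> hd (linker k X) = dollar"
  by (cases "k - 1 - length X") (auto simp: linker_def)

lemma linker_Cons: "length X < k - 1 \<Longrightarrow> linker k X = dollar # replicate (k - 2 - length X) dollar @ X"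
  unfolding linker_def by (cases "k - 1 - length X") (auto simp: numeral_2_eq_2)

lemma llabel_linker:
  assumes "set X \<subseteq> {2..\<sigma>}"
  shows "llabel (linker k X) = X"
proof (cases X)
  case (Cons a Y)
  then have "a \<noteq> 1" using assms by auto
  then show ?thesis unfolding linker_def llabel_def Cons by (subst dropWhile_append2) auto
qed (simp add: linker_def llabel_def)

lemma not_solid_and_linker: "w \<in> solid_nodes k S \<Longrightarrow> w \<notin> linker_nodes k S"
proof
  assume "w \<in> solid_nodes k S" "w \<in> linker_nodes k S"
  then obtain X where "w = linker k X" "length X < k - 1" by (auto simp: linker_nodes_iff)
  then have "dollar \<in> set w" by (simp add: linker_Cons)
  then show False using solid_symbols[OF \<open>w \<in> solid_nodes k S\<close>] by auto
qed

lemma llabel_solid: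
  assumes "set w \<subseteq> {2..\<sigma>}"
  shows "llabel w = w"
proof (cases w)
  case (Cons a Y)
  then have "a \<noteq> 1" using assms by auto
  then show ?thesis unfolding llabel_def Cons by simp
qed (simp add: llabel_def)

lemma length_node: "w \<in> nodes k S \<Longrightarrow> length w = k - 1"
  by (auto simp: nodes_def linker_nodes_iff length_linker) (auto simp: solid_nodes_def)

lemma node_nonempty: "w \<in> nodes k S \<Longrightarrow> w \<noteq> []"
  using length_node k_ge by fastforce

lemma node_symbols: "w \<in> nodes k S \<Longrightarrow> set w \<subseteq> insert 1 {2..\<sigma>}"
  using is_prefix_symbols solid_symbols by (fastforce simp: nodes_def linker_nodes_iff linker_def)

lemma finite_nodes: "finite (nodes k S)"
proof (rule finite_subset)
  show "nodes k S \<subseteq> {w. set w \<subseteq> insert 1 {2..\<sigma>} \<and> length w = k - 1}"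
    using length_node node_symbols by blast
qed (simp add: finite_lists_length_eq)

lemma linker_node: "length X < k - 1 \<Longrightarrow> is_prefix X \<Longrightarrow> linker k X \<in> nodes k S"
  by (auto simp: nodes_def linker_nodes_iff)

subsection \<open>Edges\<close>

lemma out_symbols_range: "b \<in> out w \<Longrightarrow> b \<in> {2..\<sigma>}"
  using symbols set_mono_sublist set_mono_prefix by (fastforce simp: out_symbols_def)

lemma finite_out: "finite (out w)"
  by (rule finite_subset[of _ "{2..\<sigma>}"]) (use out_symbols_range in auto)

lemma linker_in_linker_nodes: "length X < k - 1 \<Longrightarrow> is_prefix X \<Longrightarrow> linker k X \<in> linker_nodes k S"
  by (auto simp: linker_nodes_iff)

lemma out_linker:
  assumes "length X < k - 1" "is_prefix X"
  shows "b \<in> out (linker k X) \<longleftrightarrow> is_prefix (X @ [b])"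
  using assms linker_in_linker_nodes[OF assms] not_solid_and_linker llabel_linker[OF is_prefix_symbols]
  by (auto simp: out_symbols_def is_prefix_def)

lemma edge_target_linker:
  assumes "length X < k - 1"
  shows "edge_target (linker k X) b = linker k (X @ [b])"
  using assms by (simp add: edge_target_def linker_Cons) (simp add: linker_def numeral_2_eq_2)

lemma edge_target_node:
  assumes "w \<in> nodes k S" "b \<in> out w"
  shows "edge_target w b \<in> nodes k S"
proof (cases "w \<in> solid_nodes k S")
  case True
  then obtain s where s: "s \<in> S" "sublist (w @ [b]) s"
    using assms not_solid_and_linker by (auto simp: out_symbols_def)
  have "sublist (edge_target w b) s"
    using s(2) sublist_order.order_trans[OF sublist_tl] by (auto simp: edge_target_def)
  moreover have "length (edge_target w b) = k - 1"
    using length_node[OF assms(1)] by (simp add: edge_target_def)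
  ultimately show ?thesis using s(1) by (auto simp: nodes_def solid_nodes_def)
next
  case False
  then obtain X where X: "w = linker k X" "length X < k - 1" "is_prefix X"
    using assms(1) by (auto simp: nodes_def linker_nodes_iff)
  have p: "is_prefix (X @ [b])" using assms(2) X out_linker by simp
  have t: "edge_target w b = linker k (X @ [b])" using X edge_target_linker by simp
  show ?thesis
  proof (cases "length (X @ [b]) < k - 1")
    case True
    then show ?thesis using p t linker_node by simp
  next
    case False
    then have l: "length (X @ [b]) = k - 1" using X(2) by simp
    then have "edge_target w b = X @ [b]" unfolding t linker_def by simp
    then show ?thesis using p l unfolding nodes_def solid_nodes_def is_prefix_def by auto
  qed
qed

lemma incoming_edge:
  assumes "w \<in> nodes k S" "last w \<noteq> dollar"
  shows "\<exists>u\<in>nodes k S. last w \<in> out u \<and> edge_target u (last w) = w"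
proof (cases "w \<in> solid_nodes k S")
  case True
  have w: "w \<noteq> []" "length w = k - 1" using assms(1) node_nonempty length_node by auto
  obtain s ps ss where s: "s \<in> S" "s = ps @ w @ ss"
    using True by (auto simp: solid_nodes_def sublist_def)
  show ?thesis
  proof (cases ps rule: rev_cases)
    case Nil
    let ?X = "butlast w"
    have "prefix w s" using s Nil by simp
    then have "is_prefix w" using s(1) by (auto simp: is_prefix_def)
    then have pX: "is_prefix (?X @ [last w])" using w by simp
    have l: "length ?X < k - 1" using w k_ge by simp
    have "edge_target (linker k ?X) (last w) = linker k w"
      using edge_target_linker[OF l] w by simp
    also have "\<dots> = w" using w by (simp add: linker_def)
    finally show ?thesis
      using linker_node[OF l is_prefix_snocD[OF pX]] out_linker[OF l is_prefix_snocD[OF pX]] pX by blast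
  next
    case (snoc qs c)
    let ?u = "c # butlast w"
    have e: "?u @ [last w] = c # w" using w by simp
    have sub: "sublist (?u @ [last w]) s"
      unfolding e using s snoc by (metis append.assoc append_Cons append_Nil sublist_appendI)
    have "sublist ?u (?u @ [last w])" by blast
    then have "sublist ?u s" using sub sublist_order.order_trans by blast
    then have "?u \<in> solid_nodes k S" using s(1) w k_ge by (auto simp: solid_nodes_def)
    moreover have "edge_target ?u (last w) = w" using e by (simp add: edge_target_def)
    moreover have "last w \<in> out ?u"
      using sub s(1) \<open>?u \<in> solid_nodes k S\<close> unfolding out_symbols_def by blast
    ultimately show ?thesis unfolding nodes_def by blast
  qed
next
  case False
  then obtain Y where Y: "w = linker k Y" "length Y < k - 1" "is_prefix Y"
    using assms(1) by (auto simp: nodes_def linker_nodes_iff)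
  have "Y \<noteq> []" using assms(2) Y(1) k_ge by (auto simp: linker_def)
  then obtain X b where X: "Y = X @ [b]" by (metis append_butlast_last_id)
  have l: "length X < k - 1" using Y X by simp
  have b: "last w = b" using Y X by (simp add: linker_def)
  have p: "is_prefix X" using Y(3) X is_prefix_snocD by simp
  have "last w \<in> out (linker k X)" using out_linker[OF l p] Y(3) X b by simp
  moreover have "edge_target (linker k X) (last w) = w" using edge_target_linker[OF l] Y(1) X b by simp
  ultimately show ?thesis using linker_node[OF l p] by blast
qed

lemma linker_edge_source:
  assumes "u \<in> nodes k S" "length X + 1 < k - 1" "edge_target u b = edge_target (linker k X) b"
  shows "u = linker k X"
proof -
  obtain c u' where u: "u = c # u'" using node_nonempty[OF assms(1)] by (cases u) auto
  have X: "linker k X = dollar # replicate (k - 2 - length X) dollar @ X"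
    using assms(2) by (intro linker_Cons) simp
  have u': "u' = replicate (k - 2 - length X) dollar @ X"
    using assms(3) unfolding u X by (simp add: edge_target_def)
  have "dollar \<in> set u" using u u' assms(2) by auto
  then have "u \<notin> solid_nodes k S" using solid_symbols by fastforce
  then obtain Y where "u = linker k Y" "length Y < k - 1"
    using assms(1) by (auto simp: nodes_def linker_nodes_iff)
  then have "c = dollar" using hd_linker u by (metis list.sel(1))
  then show ?thesis using u u' X by simp
qed

subsection \<open>Rows\<close>

lemma rev_row: "1 \<le> i \<Longrightarrow> i \<le> N \<Longrightarrow> rev (rw i) = sorted_list_of_set (rev ` nodes k S) ! (i - 1)"
  unfolding num_rows_def row_def boss_matrix_def by simp

lemma row_less_iff:
  assumes "i \<in> {1..N}" "j \<in> {1..N}"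
  shows "rev (rw i) < rev (rw j) \<longleftrightarrow> i < j"
proof -
  let ?xs = "sorted_list_of_set (rev ` nodes k S)"
  have len: "length ?xs = N" by (simp add: num_rows_def boss_matrix_def)
  have "?xs ! (a - 1) < ?xs ! (b - 1)" if "a \<in> {1..N}" "b \<in> {1..N}" "a < b" for a b
    using that len by (intro sorted_wrt_nth_less[where P = "(<)"]) auto
  then have "rev (rw a) < rev (rw b)" if "a \<in> {1..N}" "b \<in> {1..N}" "a < b" for a b
    using that rev_row by simp
  then show ?thesis using assms by (metis less_imp_not_less linorder_neqE_nat less_irrefl)
qed

lemma row_inj: "i \<in> {1..N} \<Longrightarrow> j \<in> {1..N} \<Longrightarrow> rw i = rw j \<Longrightarrow> i = j"
  using row_less_iff by (metis less_irrefl linorder_neqE_nat)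

lemma boss_matrix_rows: "boss_matrix k S = map rw [1..<Suc N]"
  by (rule nth_equalityI) (simp_all add: num_rows_def row_def del: upt_Suc)

lemma set_boss_matrix: "set (boss_matrix k S) = nodes k S"
  using finite_nodes by (simp add: boss_matrix_def image_image)

lemma row_node: "i \<in> {1..N} \<Longrightarrow> rw i \<in> nodes k S"
  unfolding set_boss_matrix[symmetric] boss_matrix_rows by (auto simp del: upt_Suc)

lemma node_row: "w \<in> nodes k S \<Longrightarrow> \<exists>i\<in>{1..N}. rw i = w"
  unfolding set_boss_matrix[symmetric] boss_matrix_rows by (auto simp del: upt_Suc)

lemma rev_row_Cons: "i \<in> {1..N} \<Longrightarrow> rev (rw i) = last (rw i) # rev (butlast (rw i))"
  using node_nonempty[OF row_node]
  by (metis append_butlast_last_id rev.simps(2) rev_eq_Cons_iff rev_rev_ident)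

lemma last_row_mono:
  assumes "i \<in> {1..N}" "j \<in> {1..N}" "i \<le> j"
  shows "last (rw i) \<le> last (rw j)"
proof (cases "i = j")
  case False
  then have "rev (rw i) < rev (rw j)" using assms row_less_iff by simp
  then show ?thesis unfolding rev_row_Cons[OF assms(1)] rev_row_Cons[OF assms(2)] by auto
qed simp

lemma last_row_range: "i \<in> {1..N} \<Longrightarrow> last (rw i) = 1 \<or> last (rw i) \<in> {2..\<sigma>}"
  using node_symbols[OF row_node] last_in_set[OF node_nonempty[OF row_node]] by blast

lemma root_eq_if_last:
  assumes "w \<in> nodes k S" "last w = dollar"
  shows "w = linker k []"
proof -
  have "dollar \<in> set w" using assms node_nonempty last_in_set by metis
  then have "w \<notin> solid_nodes k S" using solid_symbols by fastforce
  then obtain X where X: "w = linker k X" "is_prefix X"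
    using assms(1) by (auto simp: nodes_def linker_nodes_iff)
  have "X = []"
  proof (rule ccontr)
    assume "X \<noteq> []"
    then have "dollar \<in> set X" using assms(2) X last_in_set by (fastforce simp: linker_def)
    then show False using is_prefix_symbols[OF X(2)] by auto
  qed
  then show ?thesis using X by simp
qed

lemma root_node: "linker k [] \<in> nodes k S"
  using linker_node[of "[]"] is_prefix_Nil k_ge by simp

lemma last_root: "last (linker k []) = dollar"
  using k_ge by (simp add: linker_def)

lemma num_rows_pos: "1 \<le> N"
  using node_row[OF root_node] by auto

lemma row_1: "rw 1 = linker k []"
proof -
  obtain r where r: "r \<in> {1..N}" "rw r = linker k []" using node_row[OF root_node] by auto
  have 1: "1 \<in> {1..N}" using num_rows_pos by simp
  have "last (rw 1) \<le> 1" using last_row_mono[OF 1 r(1)] r last_root by simp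
  then have "last (rw 1) = 1" using last_row_range[OF 1] by auto
  then show ?thesis using root_eq_if_last row_node 1 by blast
qed

lemma row_last_dollar_iff: "i \<in> {1..N} \<Longrightarrow> last (rw i) = dollar \<longleftrightarrow> i = 1"
  using root_eq_if_last row_node row_inj row_1 last_root num_rows_pos
  by (metis atLeastAtMost_iff order_refl)

definition rows_below :: "nat \<Rightarrow> nat" where
  "rows_below a = card {i \<in> {1..N}. last (rw i) < a}"

lemma rows_below_le: "rows_below a \<le> N"
proof -
  have "rows_below a \<le> card {1..N}" unfolding rows_below_def by (intro card_mono) auto
  then show ?thesis by simp
qed

lemma rows_below_less_iff:
  assumes i: "i \<in> {1..N}"
  shows "rows_below a < i \<longleftrightarrow> a \<le> last (rw i)"
proof
  assume "a \<le> last (rw i)"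
  have "j < i" if "j \<in> {1..N}" "last (rw j) < a" for j
    using last_row_mono[OF i that(1)] that(2) \<open>a \<le> last (rw i)\<close> by (cases "j < i") auto
  then have "{j \<in> {1..N}. last (rw j) < a} \<subseteq> {1..i - 1}" by fastforce
  then have "rows_below a \<le> card {1..i - 1}" unfolding rows_below_def by (intro card_mono) auto
  then show "rows_below a < i" using i by auto
next
  assume "rows_below a < i"
  show "a \<le> last (rw i)"
  proof (rule ccontr)
    assume "\<not> a \<le> last (rw i)"
    then have "last (rw j) < a" if "j \<in> {1..N}" "j \<le> i" for j
      using last_row_mono[OF that(1) i that(2)] by simp
    then have "{1..i} \<subseteq> {j \<in> {1..N}. last (rw j) < a}" using i by auto
    then have "card {1..i} \<le> rows_below a" unfolding rows_below_def by (intro card_mono) auto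
    then show False using \<open>rows_below a < i\<close> by simp
  qed
qed

subsection \<open>Ranks of unflagged edges\<close>

definition unflagged :: "nat \<Rightarrow> nat \<Rightarrow> bool" where
  "unflagged b r \<longleftrightarrow> b \<in> out (rw r) \<and> \<not> flagged k S r b"

definition edge_rank :: "nat \<Rightarrow> nat \<Rightarrow> nat" where
  "edge_rank b i = card {r \<in> {1..i}. unflagged b r}"

lemma edge_rank_Suc: "edge_rank b (Suc i) = edge_rank b i + (if unflagged b (Suc i) then 1 else 0)"
proof -
  have "{r \<in> {1..Suc i}. unflagged b r} =
    (if unflagged b (Suc i) then insert (Suc i) {r \<in> {1..i}. unflagged b r} else {r \<in> {1..i}. unflagged b r})"
    by (auto simp: le_Suc_eq)
  then show ?thesis by (simp add: edge_rank_def)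
qed

lemma rev_edge_target: "r \<in> {1..N} \<Longrightarrow> rev (edge_target (rw r) b) = b # butlast (rev (rw r))"
  using node_nonempty[OF row_node] by (simp add: edge_target_eq butlast_rev)

lemma edge_target_mono:
  assumes "r \<in> {1..N}" "r' \<in> {1..N}" "r \<le> r'"
  shows "rev (edge_target (rw r) b) \<le> rev (edge_target (rw r') b)"
proof -
  have "rev (rw r) \<le> rev (rw r')" using assms row_less_iff[of r r'] by (cases "r = r'") auto
  moreover have "length (rev (rw r)) = length (rev (rw r'))" using assms row_node length_node by simp
  ultimately have "butlast (rev (rw r)) \<le> butlast (rev (rw r'))" by (rule butlast_mono[rotated])
  then show ?thesis unfolding rev_edge_target[OF assms(1)] rev_edge_target[OF assms(2)] by simp
qed

lemma unflagged_source:
  assumes "i \<in> {1..N}" "last (rw i) \<noteq> dollar"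
  shows "\<exists>r\<in>{1..N}. unflagged (last (rw i)) r \<and> edge_target (rw r) (last (rw i)) = rw i"
proof -
  let ?b = "last (rw i)"
  let ?P = "\<lambda>r. r \<in> {1..N} \<and> ?b \<in> out (rw r) \<and> edge_target (rw r) ?b = rw i"
  obtain u where "u \<in> nodes k S" "?b \<in> out u" "edge_target u ?b = rw i"
    using incoming_edge[OF row_node] assms by blast
  then have "\<exists>r. ?P r" using node_row by metis
  then have P: "?P (LEAST r. ?P r)" by (rule LeastI_ex)
  have "\<not> flagged k S (LEAST r. ?P r) ?b"
  proof
    assume "flagged k S (LEAST r. ?P r) ?b"
    then obtain r where "r \<in> {1..<(LEAST r. ?P r)}" "?b \<in> out (rw r)"
      "edge_target (rw r) ?b = edge_target (rw (LEAST r. ?P r)) ?b"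
      unfolding flagged_def by blast
    then have "?P r" "r < (LEAST r. ?P r)" using P by auto
    then show False using not_less_Least by blast
  qed
  then show ?thesis using P unfolding unflagged_def by blast
qed

lemma unflagged_target_strict_mono:
  assumes "r \<in> {1..N}" "r' \<in> {1..N}" "r < r'" "unflagged b r" "unflagged b r'"
    "i \<in> {1..N}" "rw i = edge_target (rw r) b" "i' \<in> {1..N}" "rw i' = edge_target (rw r') b"
  shows "i < i'"
proof -
  have "edge_target (rw r) b \<noteq> edge_target (rw r') b"
    using assms unfolding unflagged_def flagged_def by auto
  then have "rev (rw i) < rev (rw i')"
    using edge_target_mono[of r r' b] assms by (simp add: order.strict_iff_order)
  then show ?thesis using row_less_iff assms by blast
qed

lemma target_row_eq:
  assumes "r \<in> {1..N}" "unflagged b r" "i \<in> {1..N}" "rw i = edge_target (rw r) b"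
  shows "i = rows_below b + edge_rank b r"
proof -
  have last_i: "last (rw i) = b" using assms by (simp add: edge_target_eq node_nonempty row_node)
  have b: "b \<noteq> dollar" using assms(2) out_symbols_range unfolding unflagged_def by fastforce
  define src where "src j = (SOME r. r \<in> {1..N} \<and> unflagged b r \<and> edge_target (rw r) b = rw j)" for j
  have src: "src j \<in> {1..N} \<and> unflagged b (src j) \<and> edge_target (rw (src j)) b = rw j"
    if "j \<in> {1..N}" "last (rw j) = b" for j
    unfolding src_def by (rule someI_ex) (use unflagged_source[of j] that b in blast)
  let ?A = "{j \<in> {1..N}. last (rw j) < b}" and ?B = "{j \<in> {1..i}. last (rw j) = b}"
  have i: "i \<le> N" using assms(3) by simp
  have U: "{1..i} = ?A \<union> ?B"
  proof (intro equalityI subsetI)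
    fix j assume j: "j \<in> {1..i}"
    then have "last (rw j) \<le> b" using last_row_mono[of j i] assms(3) last_i by simp
    then show "j \<in> ?A \<union> ?B" using j i by auto
  next
    fix j assume "j \<in> ?A \<union> ?B"
    moreover have "j \<le> i" if "j \<in> ?A"
      using that last_row_mono[of i j] assms(3) last_i by (cases "j \<le> i") auto
    ultimately show "j \<in> {1..i}" by auto
  qed
  have "card {1..i} = card (?A \<union> ?B)" by (rule arg_cong[OF U])
  also have "\<dots> = card ?A + card ?B" by (rule card_Un_disjoint) auto
  finally have "card {1..i} = card ?A + card ?B" .
  moreover have "bij_betw src ?B {r' \<in> {1..r}. unflagged b r'}"
  proof (rule bij_betw_imageI)
    show "inj_on src ?B"
    proof (rule inj_onI)
      fix x y assume xy: "x \<in> ?B" "y \<in> ?B" "src x = src y"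
      then have "x \<in> {1..N}" "y \<in> {1..N}" "last (rw x) = b" "last (rw y) = b" using i by auto
      then show "x = y" using src[of x] src[of y] row_inj[of x y] xy(3) by metis
    qed
    show "src ` ?B = {r' \<in> {1..r}. unflagged b r'}"
    proof (intro equalityI subsetI)
      fix x assume "x \<in> src ` ?B"
      then obtain j where j: "j \<in> {1..N}" "last (rw j) = b" "j \<le> i" "x = src j" using i by auto
      have "\<not> r < x"
        using unflagged_target_strict_mono[OF assms(1) _ _ assms(2) _ assms(3,4) j(1), of x] src[OF j(1,2)] j
        by auto
      then show "x \<in> {r' \<in> {1..r}. unflagged b r'}" using src[OF j(1,2)] j by auto
    next
      fix x assume x: "x \<in> {r' \<in> {1..r}. unflagged b r'}"
      then have xN: "x \<in> {1..N}" using assms(1) by auto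
      obtain j where j: "j \<in> {1..N}" "rw j = edge_target (rw x) b"
        using node_row edge_target_node[OF row_node[OF xN]] x unfolding unflagged_def by blast
      have lj: "last (rw j) = b" using j xN by (simp add: edge_target_eq node_nonempty row_node)
      note s = src[OF j(1) lj]
      have "\<not> x < src j" "\<not> src j < x"
        using unflagged_target_strict_mono[OF xN _ _ _ _ j j(1), of "src j"]
          unflagged_target_strict_mono[OF _ xN _ _ _ j(1) _ j, of "src j"] s x j by auto
      then have "src j = x" by simp
      moreover have "j \<le> i"
      proof (cases "x = r")
        case True
        then show ?thesis using j assms(4) row_inj[OF j(1) assms(3)] by simp
      next
        case False
        then show ?thesis
          using unflagged_target_strict_mono[OF xN assms(1) _ _ assms(2) j assms(3,4)] x by auto
      qed
      ultimately show "x \<in> src ` ?B" using j lj by force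
    qed
  qed
  then have "card ?B = edge_rank b r" unfolding edge_rank_def by (rule bij_betw_same_card)
  ultimately show ?thesis by (simp add: rows_below_def)
qed

subsection \<open>The sequences \<open>E\<close> and \<open>B\<close>\<close>

abbreviation "E \<equiv> E_seq \<sigma> k S"
abbreviation "B \<equiv> B_bitmap k S"

definition E_block :: "nat \<Rightarrow> nat list" where
  "E_block i = map (\<lambda>b. if flagged k S i b then b + \<sigma> else b) (out_list k S (rw i))"

definition B_block :: "nat \<Rightarrow> bool list" where
  "B_block i = replicate (length (E_block i) - 1) False @ [True]"

definition block_end :: "nat \<Rightarrow> nat" where
  "block_end i = length (concat (map E_block [1..<Suc i]))"

lemma block_end_0 [simp]: "block_end 0 = 0"
  by (simp add: block_end_def)

lemma block_end_Suc: "block_end (Suc i) = block_end i + length (E_block (Suc i))"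
  unfolding block_end_def concat_blocks_Suc by simp

lemma E_blocks: "E = concat (map E_block [1..<Suc N])"
  unfolding E_seq_def E_block_def ..

lemma out_list_nonempty: "out_list k S w \<noteq> []"
  using finite_out by (simp add: out_list_def)

lemma E_block_length: "1 \<le> length (E_block i)"
  using out_list_nonempty by (simp add: E_block_def Suc_le_eq)

lemma length_B_block [simp]: "length (B_block i) = length (E_block i)"
  using E_block_length[of i] by (simp add: B_block_def)

lemma B_blocks: "B = concat (map B_block [1..<Suc N])"
  unfolding B_bitmap_def boss_matrix_rows map_map
  by (rule arg_cong[where f = concat], rule map_cong) (simp_all add: B_block_def E_block_def)

lemma block_end_B: "block_end i = length (concat (map B_block [1..<Suc i]))"
  unfolding block_end_def length_concat map_map by (rule arg_cong[where f = sum_list]) simp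

lemma take_block_end_E: "i \<le> N \<Longrightarrow> take (block_end i) E = concat (map E_block [1..<Suc i])"
  unfolding E_blocks block_end_def by (rule take_concat_blocks)

lemma take_block_end_B: "i \<le> N \<Longrightarrow> take (block_end i) B = concat (map B_block [1..<Suc i])"
  unfolding B_blocks block_end_B by (rule take_concat_blocks)

lemma block_end_mono: "i \<le> j \<Longrightarrow> block_end i \<le> block_end j"
  by (rule lift_Suc_mono_le[of block_end]) (simp_all add: block_end_Suc)

lemma length_E: "length E = block_end N"
  unfolding E_blocks block_end_def ..

lemma length_B: "length B = block_end N"
  unfolding B_blocks block_end_B ..

lemma block_end_le: "i \<le> N \<Longrightarrow> block_end i \<le> length E"
  using block_end_mono length_E by simp

lemma count_E_block:
  assumes "b \<in> {2..\<sigma>}"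
  shows "count_list (E_block i) b = (if unflagged b i then 1 else 0)"
proof (cases "out (rw i) = {}")
  case True
  then show ?thesis using assms by (auto simp: E_block_def out_list_def unflagged_def flagged_def)
next
  case False
  let ?f = "\<lambda>x. if flagged k S i x then x + \<sigma> else x"
  let ?xs = "sorted_list_of_set (out (rw i))"
  have *: "?f x = b \<longleftrightarrow> x = b \<and> \<not> flagged k S i b" if "x \<in> set ?xs" for x
  proof -
    have "x \<in> {2..\<sigma>}" using that finite_out out_symbols_range by simp
    then show ?thesis using assms by auto
  qed
  have "count_list (E_block i) b = length (filter (\<lambda>x. x = b \<and> \<not> flagged k S i b) ?xs)"
    using False * by (simp add: E_block_def out_list_def count_list_map cong: filter_cong)
  also have "\<dots> = card {x \<in> out (rw i). x = b \<and> \<not> flagged k S i b}"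
    using finite_out by (subst distinct_length_filter) (auto simp: Int_def intro!: arg_cong[where f = card])
  also have "{x \<in> out (rw i). x = b \<and> \<not> flagged k S i b} = (if unflagged b i then {b} else {})"
    by (auto simp: unflagged_def)
  finally show ?thesis by simp
qed

lemma count_E_block_end:
  assumes "b \<in> {2..\<sigma>}" "i \<le> N"
  shows "count_list (take (block_end i) E) b = edge_rank b i"
  using assms(2)
proof (induction i)
  case 0
  show ?case by (simp add: edge_rank_def)
next
  case (Suc i)
  then show ?case
    by (simp only: take_block_end_E concat_blocks_Suc count_list_append Suc_leD edge_rank_Suc
        count_E_block[OF assms(1)])
qed

lemma rank_B_block_end: "i \<le> N \<Longrightarrow> bm_rank True B (block_end i) = i"
proof (induction i)
  case (Suc i)
  have "count_list (B_block (Suc i)) True = 1" by (simp add: B_block_def)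
  then show ?case using Suc
    by (simp only: bm_rank_def take_block_end_B concat_blocks_Suc count_list_append Suc_leD)
qed simp

lemma B_nth_block_end:
  assumes "Suc i \<le> N"
  shows "block_end (Suc i) - 1 < length B" "B ! (block_end (Suc i) - 1)"
proof -
  let ?j = "block_end (Suc i) - 1"
  have pos: "block_end (Suc i) \<ge> 1" using E_block_length[of "Suc i"] by (simp add: block_end_Suc)
  have le: "block_end (Suc i) \<le> length B" using assms block_end_mono length_B by simp
  show "?j < length B" using pos le by simp
  have "B ! ?j = take (block_end (Suc i)) B ! ?j" using pos by simp
  also have "take (block_end (Suc i)) B = (concat (map B_block [1..<Suc i]) @ replicate (length (E_block (Suc i)) - 1) False) @ [True]"
    unfolding take_block_end_B[OF assms] concat_blocks_Suc B_block_def[of "Suc i"] by simp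
  also have "\<dots> ! ?j = True"
  proof -
    have "length (concat (map B_block [1..<Suc i]) @ replicate (length (E_block (Suc i)) - 1) False) = ?j"
      using E_block_length[of "Suc i"] block_end_B[of i] by (simp add: block_end_Suc del: upt_Suc)
    then show ?thesis by (metis nth_append_length)
  qed
  finally show "B ! ?j" by simp
qed

lemma select_B: 
  assumes "i \<le> N"
  shows "bm_select True B i = block_end i"
proof (cases i)
  case (Suc j)
  have "Suc (block_end i - 1) = block_end i"
    using E_block_length[of i] by (simp add: Suc block_end_Suc)
  then show ?thesis
    using bm_select_rank[of "block_end i - 1" B True] B_nth_block_end[of j] rank_B_block_end[OF assms] assms
    by (simp add: Suc)
qed simp

lemma rank_B:
  assumes "Suc i \<le> N" "block_end i \<le> q" "q < block_end (Suc i)"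
  shows "bm_rank True B q = i"
proof (rule antisym)
  have "Suc (block_end (Suc i) - 1) = block_end (Suc i)" using assms(3) by simp
  then have "bm_rank True B (block_end (Suc i)) = bm_rank True B (block_end (Suc i) - 1) + 1"
    using bm_rank_Suc[OF B_nth_block_end(1)[OF assms(1)], of True] B_nth_block_end(2)[OF assms(1)] by simp
  moreover have "bm_rank True B q \<le> bm_rank True B (block_end (Suc i) - 1)"
    using assms(3) by (intro bm_rank_mono) simp
  ultimately show "bm_rank True B q \<le> i" using rank_B_block_end[OF assms(1)] by simp
  show "i \<le> bm_rank True B q"
    using bm_rank_mono[OF assms(2), of True B] rank_B_block_end[of i] assms(1) by simp
qed

lemma unflagged_position:
  assumes "r \<in> {1..N}" "unflagged b r"
  obtains p where "p < length E" "E ! p = b" "count_list (take (Suc p) E) b = edge_rank b r"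
    "bm_rank True B p = r - 1"
proof -
  obtain i where r: "r = Suc i" "Suc i \<le> N" using assms(1) by (cases r) auto
  have b: "b \<in> {2..\<sigma>}" using assms(2) out_symbols_range by (auto simp: unflagged_def)
  have "b \<in> set (E_block r)"
    using count_E_block[OF b, of r] assms(2) by (metis count_notin zero_neq_one)
  then obtain q where q: "q < length (E_block r)" "E_block r ! q = b" by (auto simp: in_set_conv_nth)
  define p where "p = block_end i + q"
  have lt: "p < block_end (Suc i)" using q r by (simp add: p_def block_end_Suc)
  have p: "p < length E" using lt block_end_le[OF r(2)] by simp
  have "E ! p = take (block_end (Suc i)) E ! p" using lt by simp
  also have "\<dots> = b"
    unfolding take_block_end_E[OF r(2)] concat_blocks_Suc p_def using q r
    by (simp add: block_end_def nth_append del: upt_Suc)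
  finally have Ep: "E ! p = b" .
  have "count_list (take (Suc p) E) b \<le> edge_rank b r"
    using count_list_take_mono[of "Suc p" "block_end r" E b] lt count_E_block_end[OF b, of r] r by simp
  moreover have "edge_rank b i \<le> count_list (take p E) b"
    using count_list_take_mono[of "block_end i" p E b] count_E_block_end[OF b, of i] r by (simp add: p_def)
  moreover have "count_list (take (Suc p) E) b = count_list (take p E) b + 1"
    using p Ep by (simp add: take_Suc_conv_app_nth)
  ultimately have "count_list (take (Suc p) E) b = edge_rank b r"
    using assms(2) r by (simp add: edge_rank_Suc)
  moreover have "bm_rank True B p = r - 1" using rank_B[OF r(2) _ lt] r by (simp add: p_def)
  ultimately show thesis using that p Ep by blast
qed

abbreviation "h \<equiv> E_height \<sigma>"

lemma two_sigma_less: "2 * \<sigma> < 2 ^ h"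
  using le_two_power_ceillog2[of "2 * \<sigma> + 1"] by (simp add: E_height_def)

lemma two_power_h_le: "2 ^ h \<le> 4 * \<sigma> + 1"
  using two_power_ceillog2_gt[of "2 * \<sigma> + 1"] by (simp add: E_height_def)

lemma E_less: "\<forall>x\<in>set E. x < 2 ^ h"
proof
  fix x assume "x \<in> set E"
  then obtain i where "x \<in> set (E_block i)" unfolding E_blocks by auto
  moreover have "y \<le> \<sigma>" if "y \<in> set (out_list k S (rw i))" for y
    using that out_symbols_range finite_out sigma_ge by (auto simp: out_list_def split: if_splits)
  ultimately have "x \<le> 2 * \<sigma>" by (fastforce simp: E_block_def split: if_splits)
  then show "x < 2 ^ h" using two_sigma_less by simp
qed

subsection \<open>Navigation\<close>

lemma backward_step:
  assumes "i \<in> {1..N}" "i \<noteq> 1"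
  obtains r p where "r \<in> {1..N}" "edge_target (rw r) (last (rw i)) = rw i"
    "p < length E" "E ! p = last (rw i)"
    "count_list (take (Suc p) E) (last (rw i)) = i - rows_below (last (rw i))"
    "bm_rank True B p = r - 1"
proof -
  have "last (rw i) \<noteq> dollar" using assms row_last_dollar_iff by blast
  then obtain r where r: "r \<in> {1..N}" "unflagged (last (rw i)) r" "edge_target (rw r) (last (rw i)) = rw i"
    using unflagged_source assms by blast
  have "i = rows_below (last (rw i)) + edge_rank (last (rw i)) r"
    using target_row_eq[OF r(1,2) assms(1)] r(3) by simp
  then show thesis using unflagged_position[OF r(1,2)] that[OF r(1,3)] by (metis add_diff_cancel_left')
qed

definition linker_row :: "str \<Rightarrow> nat" where
  "linker_row X = (if is_prefix X then (THE i. i \<in> {1..N} \<and> rw i = linker k X) else 0)"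

lemma linker_row_eqI: "is_prefix X \<Longrightarrow> i \<in> {1..N} \<Longrightarrow> rw i = linker k X \<Longrightarrow> linker_row X = i"
  unfolding linker_row_def using row_inj by (auto intro!: the_equality)

lemma linker_row:
  assumes "is_prefix X" "length X < k - 1"
  shows "linker_row X \<in> {1..N}" "rw (linker_row X) = linker k X"
proof -
  obtain i where "i \<in> {1..N}" "rw i = linker k X" using node_row[OF linker_node] assms by blast
  then show "linker_row X \<in> {1..N}" "rw (linker_row X) = linker k X"
    using linker_row_eqI[OF assms(1)] by auto
qed

lemma linker_row_Nil: "linker_row [] = 1"
  using linker_row_eqI[OF is_prefix_Nil] row_1 num_rows_pos by simp

lemma linker_row_le: "length X < k - 1 \<Longrightarrow> linker_row X \<le> N"
  using linker_row(1)[of X] by (cases "is_prefix X") (auto simp: linker_row_def)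

lemma forward_step:
  assumes "b \<in> {2..\<sigma>}" "length X + 1 < k - 1"
  defines "i \<equiv> linker_row X"
  shows "linker_row (X @ [b]) =
    (if count_list (take (block_end (i - 1)) E) b = count_list (take (block_end i) E) b then 0
     else rows_below b + count_list (take (block_end i) E) b)"
proof (cases "is_prefix X")
  case False
  then have "i = 0" "linker_row (X @ [b]) = 0"
    using is_prefix_snocD by (auto simp: i_def linker_row_def)
  then show ?thesis by simp
next
  case True
  have l: "length X < k - 1" using assms(2) by simp
  have i: "i \<in> {1..N}" "rw i = linker k X" using linker_row[OF True l] by (auto simp: i_def)
  then obtain j where j: "i = Suc j" by (cases i) auto
  \<comment> \<open>the target still starts with \<open>$\<close>, so it has only one predecessor\<close>
  have "\<not> flagged k S i b"
  proof
    assume "flagged k S i b"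
    then obtain i' where i': "i' \<in> {1..<i}" "edge_target (rw i') b = edge_target (rw i) b"
      unfolding flagged_def by blast
    then have "i' \<in> {1..N}" using i by auto
    then have "rw i' = linker k X" using linker_edge_source[OF row_node assms(2)] i' i by simp
    then have "i' = i" using row_inj[OF \<open>i' \<in> {1..N}\<close> i(1)] i(2) by simp
    then show False using i'(1) by simp
  qed
  then have u: "unflagged b i \<longleftrightarrow> is_prefix (X @ [b])"
    using out_linker[OF l True] i by (simp add: unflagged_def)
  have c: "count_list (take (block_end (i - 1)) E) b = edge_rank b j"
    "count_list (take (block_end i) E) b = edge_rank b i"
    using count_E_block_end[OF assms(1)] i j by auto
  show ?thesis
  proof (cases "is_prefix (X @ [b])")
    case False
    then have "linker_row (X @ [b]) = 0" by (simp add: linker_row_def)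
    moreover have "edge_rank b i = edge_rank b j" using False u j by (simp add: edge_rank_Suc)
    ultimately show ?thesis using c by simp
  next
    case p: True
    have "edge_rank b i = edge_rank b j + 1" using p u j by (simp add: edge_rank_Suc)
    moreover have "length (X @ [b]) < k - 1" using assms(2) by simp
    then have "linker_row (X @ [b]) = rows_below b + edge_rank b i"
      using target_row_eq[OF i(1)] u p linker_row[OF p] i(2) edge_target_linker[OF l] by metis
    ultimately show ?thesis using c by simp
  qed
qed

end

section \<open>Symbolic execution\<close>

definition runs :: "vo_boss \<Rightarrow> nat \<Rightarrow> com \<Rightarrow> (nat \<Rightarrow> mem \<Rightarrow> bool) \<Rightarrow> mem \<Rightarrow> bool" where
  "runs I W p Q s \<longleftrightarrow> (\<exists>t s'. exec I W p s t s' \<and> Q t s')"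

lemma runs_Skip [simp]: "runs I W Skip Q s \<longleftrightarrow> Q 1 s"
  unfolding runs_def by (metis exec.Skip exec_cases(1))

lemma runs_Assign [simp]:
  "runs I W (Assign x e) Q s \<longleftrightarrow> instr_val I e s < W \<and> Q 1 (s(x := instr_val I e s))"
  unfolding runs_def by (metis exec.Assign exec_cases(2))

lemma runs_Store [simp]: "runs I W (Store x y) Q s \<longleftrightarrow> Q 1 (s(s x := s y))"
  unfolding runs_def by (metis exec.Store exec_cases(3))

lemma runs_Seq [simp]:
  "runs I W (Seq p q) Q s \<longleftrightarrow> runs I W p (\<lambda>t. runs I W q (\<lambda>t'. Q (t + t'))) s"
  unfolding runs_def by (blast intro: exec.Seq elim: exec_cases)

lemma runs_If [simp]:
  "runs I W (If b p q) Q s \<longleftrightarrow>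
    (if test_val b s then runs I W p (\<lambda>t. Q (1 + t)) s else runs I W q (\<lambda>t. Q (1 + t)) s)"
proof (cases "test_val b s")
  case True
  have "exec I W (If b p q) s t s' \<longleftrightarrow> (\<exists>u. t = 1 + u \<and> exec I W p s u s')" for t s'
  proof
    assume "exec I W (If b p q) s t s'"
    then show "\<exists>u. t = 1 + u \<and> exec I W p s u s'" by (cases rule: exec_cases(5)) (use True in auto)
  next
    assume "\<exists>u. t = 1 + u \<and> exec I W p s u s'"
    then show "exec I W (If b p q) s t s'" using True exec.IfTrue by blast
  qed
  then show ?thesis unfolding runs_def using True by auto
next
  case False
  have "exec I W (If b p q) s t s' \<longleftrightarrow> (\<exists>u. t = 1 + u \<and> exec I W q s u s')" for t s'
  proof
    assume "exec I W (If b p q) s t s'"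
    then show "\<exists>u. t = 1 + u \<and> exec I W q s u s'" by (cases rule: exec_cases(5)) (use False in auto)
  next
    assume "\<exists>u. t = 1 + u \<and> exec I W q s u s'"
    then show "exec I W (If b p q) s t s'" using False exec.IfFalse by blast
  qed
  then show ?thesis unfolding runs_def using False by auto
qed

lemma runs_mono: "runs I W p Q s \<Longrightarrow> (\<And>t s'. Q t s' \<Longrightarrow> Q' t s') \<Longrightarrow> runs I W p Q' s"
  by (auto simp: runs_def)

lemma runs_While:
  assumes "Inv n s"
    and step: "\<And>n s. Inv (Suc n) s \<Longrightarrow> test_val b s \<and> runs I W p (\<lambda>t s'. t \<le> T \<and> Inv n s') s"
    and exit: "\<And>s. Inv 0 s \<Longrightarrow> \<not> test_val b s"
  shows "runs I W (While b p) (\<lambda>t s'. t \<le> 1 + n * Suc T \<and> Inv 0 s') s"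
  using assms(1)
proof (induction n arbitrary: s)
  case 0
  then show ?case using exit exec.WhileFalse by (fastforce simp: runs_def)
next
  case (Suc n)
  obtain t s' where 1: "exec I W p s t s'" "t \<le> T" "Inv n s'" and b: "test_val b s"
    using step[OF Suc.prems] by (auto simp: runs_def)
  obtain t' s'' where 2: "exec I W (While b p) s' t' s''" "t' \<le> 1 + n * Suc T" "Inv 0 s''"
    using Suc.IH[OF 1(3)] by (auto simp: runs_def)
  have "exec I W (While b p) s (1 + t + t') s''" using exec.WhileTrue b 1(1) 2(1) by blast
  moreover have "1 + t + t' \<le> 1 + Suc n * Suc T" using 1(2) 2(2) by simp
  ultimately show ?case using 2(3) by (auto simp: runs_def)
qed

definition agree :: "nat set \<Rightarrow> mem \<Rightarrow> mem \<Rightarrow> bool" where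
  "agree A s s' \<longleftrightarrow> (\<forall>a. a \<notin> A \<longrightarrow> s' a = s a)"

lemma agree_refl [simp]: "agree A s s"
  by (simp add: agree_def)

lemma agree_upd: "agree A s s' \<Longrightarrow> a \<in> A \<Longrightarrow> agree A s (s'(a := x))"
  by (auto simp: agree_def)

lemma agree_trans: "agree A s s' \<Longrightarrow> agree B s' s'' \<Longrightarrow> A \<subseteq> C \<Longrightarrow> B \<subseteq> C \<Longrightarrow> agree C s s''"
  unfolding agree_def by (metis subsetD)

section \<open>The program\<close>

notation Seq (infixr \<open>;;\<close> 60)

abbreviation (input) "rV \<equiv> 0 :: nat"
abbreviation (input) "rM \<equiv> 1 :: nat"
abbreviation (input) "rK \<equiv> 2 :: nat"
abbreviation (input) "rSigma \<equiv> 3 :: nat"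
abbreviation (input) "rHeight \<equiv> 6 :: nat"
abbreviation (input) "rOne \<equiv> 8 :: nat"
abbreviation (input) "rTwo \<equiv> 9 :: nat"
abbreviation (input) "rZero \<equiv> 10 :: nat"
abbreviation (input) "rPow \<equiv> 11 :: nat"
abbreviation (input) "rCur \<equiv> 12 :: nat"
abbreviation (input) "rLen \<equiv> 13 :: nat"
abbreviation (input) "rCount \<equiv> 14 :: nat"
abbreviation (input) "rBase \<equiv> 15 :: nat"
abbreviation (input) "rAddr \<equiv> 16 :: nat"
abbreviation (input) "rD \<equiv> 17 :: nat"
abbreviation (input) "rJ \<equiv> 18 :: nat"
abbreviation (input) "rSym \<equiv> 19 :: nat"
abbreviation (input) "rNode \<equiv> 20 :: nat"
abbreviation (input) "rPos \<equiv> 21 :: nat"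
abbreviation (input) "rChild \<equiv> 22 :: nat"
abbreviation (input) "rTmp \<equiv> 23 :: nat"
abbreviation (input) "rShift \<equiv> 24 :: nat"
abbreviation (input) "rRank \<equiv> 25 :: nat"
abbreviation (input) "rRes \<equiv> 26 :: nat"

definition init_prog :: com where
  "init_prog =
     Assign rOne (Const 1) ;; Assign rTwo (Const 2) ;; Assign rBase (Const 100) ;;
     Assign rPow (Const 1) ;; Assign rCount (Arith Add rHeight rZero) ;;
     While (Less rZero rCount)
       (Assign rPow (Arith Mul rPow rTwo) ;; Assign rCount (Arith Sub rCount rOne))"

definition select_prog :: com where
  "select_prog =
     While (Less rOne rNode)
       (Assign rChild (Arith Add rNode rZero) ;;
        Assign rNode (Arith Div rNode rTwo) ;;
        Assign rTmp (Arith Mul rNode rTwo) ;;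
        If (Equal rTmp rChild)
          (Assign rPos (Select False InE rNode rPos))
          (Assign rPos (Select True InE rNode rPos)))"

definition rank_prog :: com where
  "rank_prog =
     Assign rShift (Arith Add rPow rZero) ;;
     Assign rTmp (Arith Add rPow rSym) ;;
     While (Less rOne rShift)
       (Assign rShift (Arith Div rShift rTwo) ;;
        Assign rChild (Arith Div rTmp rShift) ;;
        Assign rNode (Arith Div rChild rTwo) ;;
        Assign rAddr (Arith Mul rNode rTwo) ;;
        If (Equal rAddr rChild)
          (Assign rPos (Rank False InE rNode rPos))
          (Assign rPos (Rank True InE rNode rPos)))"

definition last_symbol_prog :: com where
  "last_symbol_prog =
     Assign rSym (Const 0) ;; Assign rShift (Arith Add rPow rZero) ;;
     While (Less rOne rShift)
       (Assign rShift (Arith Div rShift rTwo) ;;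
        Assign rTmp (Arith Add rSym rShift) ;;
        If (Less rSigma rTmp) Skip
          (Assign rChild (ReadC rTmp) ;;
           If (Less rChild rCur) (Assign rSym (Arith Add rTmp rZero)) Skip))"

definition backward_prog :: com where
  "backward_prog =
     last_symbol_prog ;;
     Assign rTmp (ReadC rSym) ;; Assign rPos (Arith Sub rCur rTmp) ;;
     Assign rNode (Arith Add rPow rSym) ;;
     select_prog ;;
     Assign rPos (Arith Sub rPos rOne) ;; Assign rPos (Rank True InB rZero rPos) ;;
     Assign rCur (Arith Add rPos rOne)"

text \<open>The symbols of the label are stored from right to left, in the cells from address \<open>100\<close> on.\<close>

definition label_prog :: com where
  "label_prog =
     Assign rCur (Arith Add rV rZero) ;; Assign rLen (Const 0) ;;
     Assign rCount (Arith Sub rK rOne) ;;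
     While (Less rZero rCount)
       (Assign rCount (Arith Sub rCount rOne) ;;
        If (Equal rCur rOne) Skip
          (backward_prog ;;
           Assign rAddr (Arith Add rBase rLen) ;; Store rAddr rSym ;;
           Assign rLen (Arith Add rLen rOne)))"

text \<open>
  On failure the row becomes \<open>0\<close>, and it stays \<open>0\<close>: both selections in \<open>B\<close> then return \<open>0\<close>, so the
  two ranks agree.
\<close>

definition forward_prog :: com where
  "forward_prog =
     Assign rPos (Arith Sub rCur rOne) ;; Assign rPos (Select True InB rZero rPos) ;;
     rank_prog ;;
     Assign rRank (Arith Add rPos rZero) ;;
     Assign rPos (Select True InB rZero rCur) ;;
     rank_prog ;;
     If (Equal rPos rRank) (Assign rCur (Const 0))
       (Assign rTmp (ReadC rSym) ;; Assign rCur (Arith Add rTmp rPos))"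

definition walk_prog :: com where
  "walk_prog =
     Assign rCur (Const 1) ;; Assign rJ (Arith Add rD rZero) ;;
     While (Less rZero rJ)
       (Assign rJ (Arith Sub rJ rOne) ;;
        Assign rAddr (Arith Add rBase rJ) ;; Assign rSym (Load rAddr) ;;
        forward_prog)"

definition search_prog :: com where
  "search_prog =
     Assign rRes (Const 0) ;; Assign rD (Arith Add rM rZero) ;;
     While (Less rD rLen)
       (walk_prog ;;
        If (Less rRes rCur) (Assign rRes (Arith Add rCur rZero)) Skip ;;
        Assign rD (Arith Add rD rOne)) ;;
     Assign rV (Arith Add rRes rZero)"

definition nextcontained_prog :: com where
  "nextcontained_prog = init_prog ;; label_prog ;; search_prog"

locale boss_machine = boss +
  fixes m W :: nat
  assumes W_ge: "100 * (m + k + \<sigma> + num_rows k S + length (E_seq \<sigma> k S)) \<le> W"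
begin

abbreviation "I \<equiv> vo_boss_index \<sigma> k S"

lemma W_bounds: "100 < W" "k + 100 < W" "m + 1 < W" "N + length E < W" "5 * \<sigma> + 1 < W"
  using W_ge k_ge sigma_ge by auto

lemma E_tree_I [simp]: "E_tree I = wavelet h E"
  and B_bits_I [simp]: "B_bits I = B"
  by (simp_all add: vo_boss_index_def)

lemma leaf_less: "b \<le> \<sigma> \<Longrightarrow> 2 ^ h + b < W"
  using two_power_h_le W_bounds by simp

lemma powW: "n \<le> h \<Longrightarrow> 2 ^ n < W"
  using leaf_less[of 0] by (auto intro: le_less_trans[OF power_increasing[of n h "2::nat"]])

lemma ReadC_val:
  assumes "1 \<le> s x" "s x \<le> \<sigma>"
  shows "instr_val I (ReadC x) s = rows_below (s x)"
proof -
  have "[1..<Suc \<sigma>] ! (s x - 1) = s x" using assms by (subst nth_upt) auto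
  then show ?thesis using assms by (simp add: vo_boss_index_def C_array_def rows_below_def del: upt_Suc)
qed

definition consts_ok :: "mem \<Rightarrow> bool" where
  "consts_ok s \<longleftrightarrow> s rOne = 1 \<and> s rTwo = 2 \<and> s rZero = 0 \<and> s rPow = 2 ^ h \<and> s rSigma = \<sigma> \<and> s rBase = 100"

lemma consts_okD:
  assumes "consts_ok s"
  shows "s 8 = 1" "s 9 = 2" "s 10 = 0" "s 11 = 2 ^ h" "s 3 = \<sigma>" "s 15 = 100"
  using assms by (simp_all add: consts_ok_def)

lemma consts_ok_agree: "consts_ok s \<Longrightarrow> agree A s s' \<Longrightarrow> A \<inter> {3,8,9,10,11,15} = {} \<Longrightarrow> consts_ok s'"
  by (auto simp: consts_ok_def agree_def disjoint_iff)

lemma runs_select: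
  assumes c: "consts_ok s" and p: "p < length E" "E ! p = b" and b: "b \<le> \<sigma>"
    and s: "s rNode = 2 ^ h + b" "s rPos = count_list (take (Suc p) E) b"
  shows "runs I W select_prog (\<lambda>t s'. t \<le> 1 + h * 6 \<and> s' rPos = Suc p \<and>
    agree {rNode, rPos, rChild, rTmp} s s') s"
proof -
  let ?A = "{rNode, rPos, rChild, rTmp}"
  have bh: "b < 2 ^ h" using b two_sigma_less by simp
  define nd where "nd n = (2 ^ h + b) div 2 ^ (h - n)" for n
  define ps where "ps n = wpos h E b (h - n) (Suc p)" for n
  have step: "nd n = nd (Suc n) div 2" "1 < nd (Suc n)"
    "bm_select (odd (nd (Suc n))) (wbitmap (wavelet h E) (nd n)) (ps (Suc n)) = ps n" if "Suc n \<le> h" for n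
  proof -
    define e where "e = h - Suc n"
    have e: "h - Suc n = e" "h - n = Suc e" "e < h" using that by (auto simp: e_def)
    show 1: "nd n = nd (Suc n) div 2"
      unfolding nd_def e by (metis div_mult2_eq mult.commute power_Suc)
    have "nd n div 2 ^ n = (2 ^ h + b) div 2 ^ h"
      unfolding nd_def using that by (metis Suc_leD div_mult2_eq le_add_diff_inverse2 power_add)
    then have "nd n \<noteq> 0" using bh by (intro notI) simp
    then show "1 < nd (Suc n)" unfolding 1 by simp
    show "bm_select (odd (nd (Suc n))) (wbitmap (wavelet h E) (nd n)) (ps (Suc n)) = ps n"
      unfolding nd_def ps_def e by (rule wpos_select[OF E_less e(3) p])
  qed
  have nd: "nd 0 = 1" "nd h = 2 ^ h + b" using bh by (simp_all add: nd_def)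
  have ps: "ps 0 = Suc p" "ps h = count_list (take (Suc p) E) b"
    using wpos_root[OF E_less bh, of "Suc p"] p by (simp_all add: ps_def wpos_leaf)
  have ndW: "nd n < W" for n
    using leaf_less[OF b] unfolding nd_def by (meson div_le_dividend le_less_trans)
  have psW: "ps n < W" for n
    unfolding ps_def using wpos_le[of h E b "h - n" "Suc p"] p W_bounds by simp
  have even: "a div 2 * 2 = a \<longleftrightarrow> even a" for a :: nat by (metis dvd_div_mult_self dvd_triv_right)
  let ?Inv = "\<lambda>n s'. n \<le> h \<and> s' rNode = nd n \<and> s' rPos = ps n \<and> agree ?A s s'"
  have "runs I W select_prog (\<lambda>t s'. t \<le> 1 + h * Suc 5 \<and> ?Inv 0 s') s"
    unfolding select_prog_def
  proof (rule runs_While, goal_cases)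
    case 1
    show ?case using s nd ps by simp
  next
    case (2 n s')
    have g: "s' 8 = 1" "s' 9 = 2" "s' 10 = 0"
      using 2 consts_okD[OF c] by (simp_all add: agree_def)
    have n: "Suc n \<le> h" using 2 by simp
    have tmp: "nd (Suc n) div 2 * 2 < W"
      using ndW[of "Suc n"] by (meson div_times_less_eq_dividend le_less_trans)
    show ?case
      using 2 tmp step[OF n] ndW[of n] ndW[of "Suc n"] psW[of n] by (auto simp: g even intro!: agree_upd)
  next
    case (3 s')
    then have "s' 8 = 1" using consts_okD[OF c] by (simp add: agree_def)
    then show ?case using 3 nd by simp
  qed
  then show ?thesis by (rule runs_mono) (use ps in auto)
qed

lemma runs_rank:
  assumes c: "consts_ok s" and p: "p \<le> length E" and b: "b \<le> \<sigma>"
    and s: "s rSym = b" "s rPos = p"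
  shows "runs I W rank_prog (\<lambda>t s'. t \<le> 3 + h * 7 \<and> s' rPos = count_list (take p E) b \<and>
    agree {rAddr, rNode, rPos, rChild, rTmp, rShift} s s') s"
proof -
  let ?A = "{rAddr, rNode, rPos, rChild, rTmp, rShift}"
  have bh: "b < 2 ^ h" using b two_sigma_less by simp
  define nd where "nd n = (2 ^ h + b) div 2 ^ n" for n
  define ps where "ps n = wpos h E b n p" for n
  have step: "nd (Suc n) = nd n div 2"
    "bm_rank (odd (nd n)) (wbitmap (wavelet h E) (nd (Suc n))) (ps (Suc n)) = ps n" if "Suc n \<le> h" for n
  proof -
    show "nd (Suc n) = nd n div 2"
      unfolding nd_def by (metis div_mult2_eq mult.commute power_Suc)
    show "bm_rank (odd (nd n)) (wbitmap (wavelet h E) (nd (Suc n))) (ps (Suc n)) = ps n"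
      unfolding nd_def ps_def by (rule wpos_rank[OF E_less bh]) (use that in simp)
  qed
  have ps: "ps h = p" "ps 0 = count_list (take p E) b"
    using wpos_root[OF E_less bh p] by (simp_all add: ps_def wpos_leaf)
  have ndW: "nd n < W" for n
    using leaf_less[OF b] unfolding nd_def by (meson div_le_dividend le_less_trans)
  have psW: "ps n < W" for n
    unfolding ps_def using wpos_le[of h E b n p] p W_bounds by simp
  have even: "a div 2 * 2 = a \<longleftrightarrow> even a" for a :: nat by (metis dvd_div_mult_self dvd_triv_right)
  let ?Inv = "\<lambda>n s'. n \<le> h \<and> s' rShift = 2 ^ n \<and> s' rTmp = 2 ^ h + b \<and> s' rPos = ps n \<and> agree ?A s s'"
  define s1 where "s1 = s(rShift := 2 ^ h, rTmp := 2 ^ h + b)"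
  have "runs I W (While (Less rOne rShift)
       (Assign rShift (Arith Div rShift rTwo) ;;
        Assign rChild (Arith Div rTmp rShift) ;;
        Assign rNode (Arith Div rChild rTwo) ;;
        Assign rAddr (Arith Mul rNode rTwo) ;;
        If (Equal rAddr rChild)
          (Assign rPos (Rank False InE rNode rPos))
          (Assign rPos (Rank True InE rNode rPos)))) (\<lambda>t s'. t \<le> 1 + h * Suc 6 \<and> ?Inv 0 s') s1"
  proof (rule runs_While, goal_cases)
    case 1
    show ?case using s ps by (auto simp: s1_def agree_def)
  next
    case (2 n s')
    have g: "s' 8 = 1" "s' 9 = 2" "s' 10 = 0"
      using 2 consts_okD[OF c] by (simp_all add: agree_def)
    have n: "Suc n \<le> h" using 2 by simp
    have tmp: "nd n div 2 * 2 < W"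
      using ndW[of n] by (meson div_times_less_eq_dividend le_less_trans)
    have pw: "2 ^ n < W" using powW n by simp
    have nd: "(2 ^ h + b) div 2 ^ n = nd n" by (simp add: nd_def)
    show ?case
      using 2 tmp step[OF n] ndW[of n] ndW[of "Suc n"] psW[of n] pw one_less_power[of "2::nat" "Suc n"]
      by (auto simp: g even nd intro!: agree_upd)
  next
    case (3 s')
    then have "s' 8 = 1" using consts_okD[OF c] by (simp add: agree_def)
    then show ?case using 3 by simp
  qed
  then show ?thesis
    unfolding rank_prog_def using consts_okD[OF c] s leaf_less[OF b] powW[of h] ps
    by (auto simp: s1_def elim!: runs_mono)
qed

lemma runs_last_symbol:
  assumes c: "consts_ok s" and i: "i \<in> {1..N}" "s rCur = i"
  shows "runs I W last_symbol_prog (\<lambda>t s'. t \<le> 3 + h * 7 \<and> s' rSym = last (rw i) \<and>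
    agree {rSym, rChild, rTmp, rShift} s s') s"
proof -
  let ?A = "{rSym, rChild, rTmp, rShift}"
  let ?l = "last (rw i)"
  have l: "1 \<le> ?l" "?l \<le> \<sigma>" using last_row_range[OF i(1)] sigma_ge by auto
  let ?Inv = "\<lambda>n s'. n \<le> h \<and> s' rShift = 2 ^ n \<and> s' rSym \<le> ?l \<and> ?l < s' rSym + 2 ^ n \<and> agree ?A s s'"
  define s1 where "s1 = s(rSym := 0, rShift := 2 ^ h)"
  have "runs I W (While (Less rOne rShift)
       (Assign rShift (Arith Div rShift rTwo) ;;
        Assign rTmp (Arith Add rSym rShift) ;;
        If (Less rSigma rTmp) Skip
          (Assign rChild (ReadC rTmp) ;;
           If (Less rChild rCur) (Assign rSym (Arith Add rTmp rZero)) Skip)))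
     (\<lambda>t s'. t \<le> 1 + h * Suc 6 \<and> ?Inv 0 s') s1"
  proof (rule runs_While, goal_cases)
    case 1
    show ?case using l two_sigma_less by (auto simp: s1_def agree_def)
  next
    case (2 n s')
    have g: "s' 8 = 1" "s' 9 = 2" "s' 10 = 0" "s' 3 = \<sigma>" "s' 12 = i"
      using 2 consts_okD[OF c] i by (simp_all add: agree_def)
    have pw: "2 ^ n < W" using powW 2 by simp
    let ?x = "s' rSym + 2 ^ n"
    have "(2::nat) ^ n \<le> 2 ^ h" using 2 by (intro power_increasing) auto
    then have xW: "?x < W" using 2 l leaf_less[of "s' rSym"] by linarith
    have x1: "1 \<le> ?x" by (simp add: Suc_leI)
    have rd: "instr_val I (ReadC rTmp) u = rows_below ?x" if "u rTmp = ?x" "?x \<le> \<sigma>" for u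
      using ReadC_val[of u rTmp] that x1 by simp
    have rW: "rows_below ?x < W" using rows_below_le[of ?x] W_bounds by simp
    have iff: "rows_below ?x < i \<longleftrightarrow> ?x \<le> ?l" using rows_below_less_iff[OF i(1)] by blast
    have test: "test_val (Less rOne rShift) s'" using 2 g one_less_power[of "2::nat" "Suc n"] by simp
    show ?case
    proof (cases "\<sigma> < ?x")
      case True
      then show ?thesis using 2 l pw xW test by (auto simp: g intro!: agree_upd)
    next
      case False
      then show ?thesis using 2 pw xW rW iff test rd
        by (auto simp: g simp del: instr_val.simps(4) intro!: agree_upd)
    qed
  next
    case (3 s')
    then have "s' 8 = 1" using consts_okD[OF c] by (simp add: agree_def)
    then show ?case using 3 by simp
  qed
  then show ?thesis
    unfolding last_symbol_prog_def using consts_okD[OF c] powW[of h] W_bounds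
    by (auto simp: s1_def elim!: runs_mono)
qed

lemma runs_backward:
  assumes c: "consts_ok s" and i: "i \<in> {1..N}" "i \<noteq> 1" "s rCur = i"
  shows "runs I W backward_prog (\<lambda>t s'. t \<le> 10 + h * 13 \<and> s' rSym = last (rw i) \<and>
    s' rCur \<in> {1..N} \<and> edge_target (rw (s' rCur)) (last (rw i)) = rw i \<and>
    agree {rCur, rSym, rNode, rPos, rChild, rTmp, rShift} s s') s"
proof -
  let ?A = "{rCur, rSym, rNode, rPos, rChild, rTmp, rShift}"
  let ?l = "last (rw i)"
  obtain r p where r: "r \<in> {1..N}" "edge_target (rw r) ?l = rw i"
    and p: "p < length E" "E ! p = ?l" "count_list (take (Suc p) E) ?l = i - rows_below ?l"
    "bm_rank True B p = r - 1"
    using backward_step[OF i(1,2)] by blast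
  have l: "1 \<le> ?l" "?l \<le> \<sigma>" using last_row_range[OF i(1)] sigma_ge by auto
  have rest: "runs I W (Assign rTmp (ReadC rSym) ;; Assign rPos (Arith Sub rCur rTmp) ;;
     Assign rNode (Arith Add rPow rSym) ;;
     select_prog ;;
     Assign rPos (Arith Sub rPos rOne) ;; Assign rPos (Rank True InB rZero rPos) ;;
     Assign rCur (Arith Add rPos rOne))
     (\<lambda>t s'. t \<le> 7 + h * 6 \<and> s' rSym = ?l \<and> s' rCur = r \<and> agree ?A s s') s1"
    if s1: "s1 rSym = ?l" "agree {rSym, rChild, rTmp, rShift} s s1" for s1
  proof -
    have g: "s1 8 = 1" "s1 9 = 2" "s1 10 = 0" "s1 11 = 2 ^ h" "s1 12 = i"
      using s1 consts_okD[OF c] i by (simp_all add: agree_def)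
    have rd: "instr_val I (ReadC rSym) s1 = rows_below ?l" using ReadC_val[of s1 rSym] s1 l by simp
    have rW: "rows_below ?l < W" "i - rows_below ?l < W" "2 ^ h + ?l < W" "p < W" "r - 1 < W" "r < W"
      using rows_below_le[of ?l] W_bounds i leaf_less l p(1) r by auto
    define s2 where "s2 = s1(rTmp := rows_below ?l, rPos := i - rows_below ?l, rNode := 2 ^ h + ?l)"
    have a2: "agree ?A s s2" using s1(2) by (auto simp: s2_def agree_def)
    have "consts_ok s2" by (rule consts_ok_agree[OF c a2]) simp
    then have sel: "runs I W select_prog (\<lambda>t s'. t \<le> 1 + h * 6 \<and> s' rPos = Suc p \<and>
      agree {rNode, rPos, rChild, rTmp} s2 s') s2"
      by (rule runs_select[OF _ p(1,2) l(2)]) (simp_all add: s2_def p)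
    have "runs I W (select_prog ;;
     Assign rPos (Arith Sub rPos rOne) ;; Assign rPos (Rank True InB rZero rPos) ;;
     Assign rCur (Arith Add rPos rOne))
      (\<lambda>t s'. t \<le> 4 + h * 6 \<and> s' rSym = ?l \<and> s' rCur = r \<and> agree ?A s s') s2"
      unfolding runs_Seq
    proof (rule runs_mono[OF sel], goal_cases)
      case (1 t s3)
      have "s3 8 = 1" "s3 10 = 0" "s3 19 = ?l" using 1 g s1 by (simp_all add: agree_def s2_def)
      moreover have "agree ?A s s3" using 1 by (intro agree_trans[OF a2, of _ s3]) auto
      ultimately show ?case using 1 p(4) rW r(1) by (auto intro!: agree_upd)
    qed
    then show ?thesis
      using rW by (simp add: g rd s1 del: instr_val.simps(4) flip: s2_def)
  qed
  show ?thesis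
    unfolding backward_prog_def runs_Seq[of _ _ last_symbol_prog]
  proof (rule runs_mono[OF runs_last_symbol[OF c i(1,3)]], goal_cases)
    case (1 t s1)
    then show ?case by (intro runs_mono[OF rest]) (use r in auto)
  qed
qed

subsection \<open>Reading the label\<close>

definition label_inv :: "nat \<Rightarrow> nat \<Rightarrow> nat \<Rightarrow> bool" where
  "label_inv v n r \<longleftrightarrow> n \<le> k - 1 \<and> r \<in> {1..N} \<and> suffix (take (k - 1 - n) (rw v)) (rw r) \<and>
     set (drop (k - 1 - n) (rw v)) \<subseteq> {2..\<sigma>}"

lemma label_inv_0: "v \<in> {1..N} \<Longrightarrow> label_inv v 0 v"
  using length_node[OF row_node] by (simp add: label_inv_def)

lemma label_inv_Suc:
  assumes v: "v \<in> {1..N}" and inv: "label_inv v n r" and "n < k - 1" "r \<noteq> 1"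
    and r': "r' \<in> {1..N}" "edge_target (rw r') (last (rw r)) = rw r"
  shows "label_inv v (Suc n) r'" "last (rw r) = rev (rw v) ! n"
proof -
  define j where "j = k - 1 - Suc n"
  have j: "k - 1 - n = Suc j" "k - 1 - Suc n = j" using assms(3) by (auto simp: j_def)
  have len: "length (rw v) = k - 1" using length_node[OF row_node[OF v]] .
  then have jl: "j < length (rw v)" using assms(3) by (simp add: j_def)
  have t: "take (Suc j) (rw v) = take j (rw v) @ [rw v ! j]" using jl by (rule take_Suc_conv_app_nth)
  have suf: "suffix (take j (rw v) @ [rw v ! j]) (rw r)" using inv unfolding label_inv_def j t by simp
  then have l: "last (rw r) = rw v ! j" by (auto simp: suffix_def)
  show "last (rw r) = rev (rw v) ! n"
    using l len assms(3) by (simp add: rev_nth j_def)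
  have r: "r \<in> {1..N}" using inv by (simp add: label_inv_def)
  have "last (rw r) \<in> {2..\<sigma>}"
    using last_row_range[OF r] row_last_dollar_iff[OF r] assms(4) by blast
  moreover have "drop j (rw v) = rw v ! j # drop (Suc j) (rw v)"
    using jl by (rule Cons_nth_drop_Suc[symmetric])
  ultimately have "set (drop j (rw v)) \<subseteq> {2..\<sigma>}"
    using inv l unfolding label_inv_def j by simp
  moreover have "tl (rw r') @ [last (rw r)] = rw r"
    using r'(2) node_nonempty[OF row_node[OF r'(1)]] by (simp add: edge_target_eq)
  then have "suffix (take j (rw v)) (tl (rw r'))"
    using suf l by (metis snoc_suffix_snoc)
  then have "suffix (take j (rw v)) (rw r')" using suffix_tl suffix_order.order_trans by blast
  ultimately show "label_inv v (Suc n) r'"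
    using r'(1) assms(3) unfolding label_inv_def j by simp
qed

lemma label_inv_final:
  assumes v: "v \<in> {1..N}" and inv: "label_inv v n r" and "n = k - 1 \<or> r = 1"
  shows "llabel (rw v) = drop (k - 1 - n) (rw v)"
proof -
  let ?X = "drop (k - 1 - n) (rw v)"
  have len: "length (rw v) = k - 1" using length_node[OF row_node[OF v]] .
  have n: "n \<le> k - 1" using inv by (simp add: label_inv_def)
  have "take (k - 1 - n) (rw v) = replicate (k - 1 - n) dollar"
  proof (cases "n = k - 1")
    case False
    then have "suffix (take (k - 1 - n) (rw v)) (linker k [])"
      using assms(3) inv row_1 by (simp add: label_inv_def)
    then have "set (take (k - 1 - n) (rw v)) \<subseteq> {dollar}"
      using set_mono_suffix by (fastforce simp: linker_def)
    then show ?thesis using len by (intro replicate_eqI) auto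
  qed simp
  moreover have "k - 1 - length ?X = k - 1 - n" using len n by simp
  ultimately have "rw v = linker k ?X"
    using append_take_drop_id[of "k - 1 - n" "rw v"] unfolding linker_def by metis
  moreover have "set ?X \<subseteq> {2..\<sigma>}" using inv by (simp add: label_inv_def)
  ultimately show ?thesis using llabel_linker by metis
qed

lemma runs_label:
  assumes c: "consts_ok s" and v: "v \<in> {1..N}" "s rV = v" "s rK = k"
  shows "runs I W label_prog (\<lambda>t s'. t \<le> 4 + k * (16 + h * 13) \<and>
    s' rLen = length (llabel (rw v)) \<and> (\<forall>i < length (llabel (rw v)). s' (100 + i) = rev (llabel (rw v)) ! i) \<and>
    consts_ok s' \<and> s' rM = s rM) s"
proof -
  let ?A = "{rCur, rLen, rCount, rAddr, rSym, rNode, rPos, rChild, rTmp, rShift} \<union> {100..}"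
  let ?Inv = "\<lambda>n s'. s' rCount = n \<and> n \<le> k - 1 \<and> label_inv v (s' rLen) (s' rCur) \<and>
     (s' rLen + n = k - 1 \<or> s' rCur = 1) \<and> (\<forall>i < s' rLen. s' (100 + i) = rev (rw v) ! i) \<and> agree ?A s s'"
  define s1 where "s1 = s(rCur := v, rLen := 0, rCount := k - 1)"
  let ?body = "Assign rCount (Arith Sub rCount rOne) ;;
        If (Equal rCur rOne) Skip
          (backward_prog ;;
           Assign rAddr (Arith Add rBase rLen) ;; Store rAddr rSym ;;
           Assign rLen (Arith Add rLen rOne))"
  have loop: "runs I W (While (Less rZero rCount) ?body)
    (\<lambda>t s'. t \<le> 1 + (k - 1) * Suc (15 + h * 13) \<and> ?Inv 0 s') s1"
  proof (rule runs_While, goal_cases)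
    case 1
    show ?case using label_inv_0[OF v(1)] by (auto simp: s1_def agree_def)
  next
    case (2 n s')
    have g: "s' 8 = 1" "s' 10 = 0" "s' 15 = 100"
      using 2 consts_okD[OF c] by (simp_all add: agree_def)
    have n: "s' 14 = Suc n" "n < W" using 2 W_bounds by auto
    define s2 where "s2 = s'(rCount := n)"
    have a2: "agree ?A s s2" using 2 by (auto simp: s2_def agree_def)
    have c2: "consts_ok s2" by (rule consts_ok_agree[OF c a2]) simp
    have "runs I W (If (Equal rCur rOne) Skip
          (backward_prog ;;
           Assign rAddr (Arith Add rBase rLen) ;; Store rAddr rSym ;;
           Assign rLen (Arith Add rLen rOne))) (\<lambda>t s'. t \<le> 14 + h * 13 \<and> ?Inv n s') s2"
    proof (cases "s' rCur = 1")
      case True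
      then show ?thesis using 2 a2 g by (auto simp: s2_def)
    next
      case False
      have L: "s' rLen + Suc n = k - 1" using 2 False by simp
      have i: "s' rCur \<in> {1..N}" using 2 by (simp add: label_inv_def)
      have bk: "runs I W backward_prog (\<lambda>t s3. t \<le> 10 + h * 13 \<and> s3 rSym = last (rw (s' rCur)) \<and>
        s3 rCur \<in> {1..N} \<and> edge_target (rw (s3 rCur)) (last (rw (s' rCur))) = rw (s' rCur) \<and>
        agree {rCur, rSym, rNode, rPos, rChild, rTmp, rShift} s2 s3) s2"
        by (rule runs_backward[OF c2 i False]) (simp add: s2_def)
      have "runs I W (backward_prog ;;
           Assign rAddr (Arith Add rBase rLen) ;; Store rAddr rSym ;;
           Assign rLen (Arith Add rLen rOne)) (\<lambda>t s'. t \<le> 13 + h * 13 \<and> ?Inv n s') s2"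
        unfolding runs_Seq
      proof (rule runs_mono[OF bk], goal_cases)
        case (1 t s3)
        have s3: "s3 8 = 1" "s3 15 = 100" "s3 13 = s' 13" "s3 14 = n" "s3 (100 + j) = s' (100 + j)" for j
          using 1 g by (simp_all add: agree_def s2_def)
        have a3: "agree ?A s s3"
          using 1 by (intro agree_trans[OF a2, of _ s3]) auto
        have lab: "label_inv v (Suc (s' 13)) (s3 12)" "last (rw (s' 12)) = rev (rw v) ! s' 13"
          using label_inv_Suc[OF v(1), of "s' 13" "s' 12" "s3 12"] 2 1 L False by simp_all
        show ?case using 1 2 L lab a3 W_bounds
          by (auto simp: s3 less_Suc_eq intro!: agree_upd)
      qed
      then show ?thesis using False g by (auto simp: s2_def elim!: runs_mono)
    qed
    then show ?case using n by (auto simp: g s2_def elim!: runs_mono)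
  next
    case (3 s')
    then show ?case by simp
  qed
  have "runs I W label_prog (\<lambda>t s'. t \<le> 4 + (k - 1) * (16 + h * 13) \<and> ?Inv 0 s') s"
    unfolding label_prog_def using loop v consts_okD[OF c] W_bounds
    by (auto simp: s1_def elim!: runs_mono)
  then show ?thesis
  proof (rule runs_mono, goal_cases)
    case (1 t s')
    have lab: "llabel (rw v) = drop (k - 1 - s' rLen) (rw v)"
      using 1 by (intro label_inv_final[OF v(1), of _ "s' rCur"]) auto
    have len: "length (rw v) = k - 1" using length_node[OF row_node[OF v(1)]] .
    have le: "s' rLen \<le> k - 1" using 1 by (simp add: label_inv_def)
    have L: "length (llabel (rw v)) = s' rLen" unfolding lab using len le by simp
    have "rev (llabel (rw v)) = take (s' rLen) (rev (rw v))"
    proof -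
      have "length (rw v) - (k - 1 - s' rLen) = s' rLen" using len le by simp
      then show ?thesis unfolding lab rev_drop by simp
    qed
    then have "\<forall>i < s' rLen. s' (100 + i) = rev (llabel (rw v)) ! i" using 1 by simp
    moreover have "consts_ok s'" by (rule consts_ok_agree[OF c, of ?A]) (use 1 in auto)
    moreover have "s' rM = s rM" using 1 by (simp add: agree_def)
    moreover have "t \<le> 4 + k * (16 + h * 13)"
      using 1 mult_le_mono1[of "k - 1" k "16 + h * 13"] by linarith
    ultimately show ?case using L by simp
  qed
qed

subsection \<open>Searching for linkers\<close>

lemma runs_forward:
  assumes c: "consts_ok s" and b: "b \<in> {2..\<sigma>}" "s rSym = b"
    and X: "length X + 1 < k - 1" "s rCur = linker_row X"
  shows "runs I W forward_prog (\<lambda>t s'. t \<le> 13 + h * 14 \<and> s' rCur = linker_row (X @ [b]) \<and>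
    agree {rCur, rAddr, rNode, rPos, rChild, rTmp, rShift, rRank} s s') s"
proof -
  let ?A = "{rCur, rAddr, rNode, rPos, rChild, rTmp, rShift, rRank}"
  let ?R = "{rAddr, rNode, rPos, rChild, rTmp, rShift}"
  define i where "i = linker_row X"
  define c1 where "c1 = count_list (take (block_end (i - 1)) E) b"
  define c2 where "c2 = count_list (take (block_end i) E) b"
  have iN: "i \<le> N" "i - 1 \<le> N" using linker_row_le[of X] X by (auto simp: i_def)
  have fs: "linker_row (X @ [b]) = (if c1 = c2 then 0 else rows_below b + c2)"
    using forward_step[OF b(1) X(1)] by (simp add: c1_def c2_def i_def)
  have ends: "block_end i \<le> length E" "block_end (i - 1) \<le> length E"
    using block_end_le iN by blast+
  have "c1 \<le> length E" "c2 \<le> length E"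
    unfolding c1_def c2_def using count_le_length[of "take _ E" b] by (auto intro: order_trans)
  then have bnd: "i < W" "block_end i < W" "block_end (i - 1) < W" "c1 < W" "rows_below b < W" "rows_below b + c2 < W"
    using ends W_bounds iN rows_below_le[of b] by auto
  have b\<sigma>: "1 \<le> b" "b \<le> \<sigma>" using b by auto
  have g: "s 8 = 1" "s 10 = 0" "s 12 = i" "s 19 = b" using consts_okD[OF c] b X by (simp_all add: i_def)
  define s1 where "s1 = s(rPos := block_end (i - 1))"
  have a1: "agree ?A s s1" by (auto simp: s1_def agree_def)
  have k1: "consts_ok s1" by (rule consts_ok_agree[OF c a1]) simp
  have r1: "runs I W rank_prog (\<lambda>t s'. t \<le> 3 + h * 7 \<and> s' rPos = c1 \<and> agree ?R s1 s') s1"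
    unfolding c1_def by (rule runs_rank[OF k1 ends(2) b\<sigma>(2)]) (simp_all add: s1_def g)
  have rest: "runs I W (Assign rRank (Arith Add rPos rZero) ;;
     Assign rPos (Select True InB rZero rCur) ;;
     rank_prog ;;
     If (Equal rPos rRank) (Assign rCur (Const 0))
       (Assign rTmp (ReadC rSym) ;; Assign rCur (Arith Add rTmp rPos)))
    (\<lambda>t s'. t \<le> 8 + h * 7 \<and> s' rCur = linker_row (X @ [b]) \<and> agree ?A s s') s2"
    if s2: "s2 rPos = c1" "agree ?R s1 s2" for s2
  proof -
    have g2: "s2 8 = 1" "s2 10 = 0" "s2 12 = i" "s2 19 = b"
      using s2 g by (simp_all add: agree_def s1_def)
    define s3 where "s3 = s2(rRank := c1, rPos := block_end i)"
    have a2: "agree ?A s s2" using s2(2) by (intro agree_trans[OF a1, of _ s2]) auto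
    then have a3: "agree ?A s s3" by (auto simp: s3_def intro!: agree_upd)
    have k3: "consts_ok s3" by (rule consts_ok_agree[OF c a3]) simp
    have r2: "runs I W rank_prog (\<lambda>t s'. t \<le> 3 + h * 7 \<and> s' rPos = c2 \<and> agree ?R s3 s') s3"
      unfolding c2_def by (rule runs_rank[OF k3 ends(1) b\<sigma>(2)]) (simp_all add: s3_def g2)
    have "runs I W (rank_prog ;;
     If (Equal rPos rRank) (Assign rCur (Const 0))
       (Assign rTmp (ReadC rSym) ;; Assign rCur (Arith Add rTmp rPos)))
      (\<lambda>t s'. t \<le> 6 + h * 7 \<and> s' rCur = linker_row (X @ [b]) \<and> agree ?A s s') s3"
      unfolding runs_Seq[of _ _ rank_prog]
    proof (rule runs_mono[OF r2], goal_cases)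
      case (1 t s4)
      have g4: "s4 19 = b" "s4 25 = c1" "s4 21 = c2" using 1 g2 by (simp_all add: agree_def s3_def)
      have a4: "agree ?A s s4" using 1 by (intro agree_trans[OF a3, of _ s4]) auto
      have rd: "instr_val I (ReadC rSym) s4 = rows_below b" using ReadC_val[of s4 rSym] g4 b\<sigma> by simp
      show ?case using 1 a4 bnd W_bounds fs
        by (auto simp: g4 rd simp del: instr_val.simps(4) intro!: agree_upd)
    qed
    then show ?thesis
      using bnd select_B[OF iN(1)] s2(1) by (auto simp: g2 s3_def elim!: runs_mono)
  qed
  have "runs I W (rank_prog ;; Assign rRank (Arith Add rPos rZero) ;;
     Assign rPos (Select True InB rZero rCur) ;;
     rank_prog ;;
     If (Equal rPos rRank) (Assign rCur (Const 0))
       (Assign rTmp (ReadC rSym) ;; Assign rCur (Arith Add rTmp rPos)))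
    (\<lambda>t s'. t \<le> 11 + h * 14 \<and> s' rCur = linker_row (X @ [b]) \<and> agree ?A s s') s1"
    unfolding runs_Seq[of _ _ rank_prog "Assign rRank _ ;; _"]
  proof (rule runs_mono[OF r1], goal_cases)
    case (1 t s2)
    then show ?case by (intro runs_mono[OF rest]) auto
  qed
  then show ?thesis
    unfolding forward_prog_def using bnd select_B[OF iN(2)]
    by (auto simp: g s1_def elim!: runs_mono)
qed

lemma runs_walk:
  assumes c: "consts_ok s" and d: "s rD = d" "d < length y" and y: "length y \<le> k - 1" "set y \<subseteq> {2..\<sigma>}"
    and s: "\<forall>i < length y. s (100 + i) = y ! i"
  shows "runs I W walk_prog (\<lambda>t s'. t \<le> 3 + d * (17 + h * 14) \<and> s' rCur = linker_row (rev (take d y)) \<and>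
    agree {rCur, rAddr, rJ, rSym, rNode, rPos, rChild, rTmp, rShift, rRank} s s') s"
proof -
  let ?A = "{rCur, rAddr, rJ, rSym, rNode, rPos, rChild, rTmp, rShift, rRank}"
  let ?F = "{rCur, rAddr, rNode, rPos, rChild, rTmp, rShift, rRank}"
  let ?X = "\<lambda>j. rev (drop j (take d y))"
  let ?Inv = "\<lambda>j s'. j \<le> d \<and> s' rJ = j \<and> s' rCur = linker_row (?X j) \<and> agree ?A s s'"
  define s1 where "s1 = s(rCur := 1, rJ := d)"
  have loop: "runs I W (While (Less rZero rJ)
       (Assign rJ (Arith Sub rJ rOne) ;;
        Assign rAddr (Arith Add rBase rJ) ;; Assign rSym (Load rAddr) ;;
        forward_prog)) (\<lambda>t s'. t \<le> 1 + d * Suc (16 + h * 14) \<and> ?Inv 0 s') s1"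
  proof (rule runs_While, goal_cases)
    case 1
    show ?case using linker_row_Nil by (auto simp: s1_def agree_def)
  next
    case (2 j s')
    have j: "j < d" "j < length y" using 2 d by auto
    then have b: "y ! j \<in> {2..\<sigma>}" using y(2) nth_mem by blast
    have X: "?X j = ?X (Suc j) @ [y ! j]"
      using j by (simp add: Cons_nth_drop_Suc[symmetric])
    have lX: "length (?X (Suc j)) + 1 < k - 1" using j d y(1) by simp
    have g: "s' 8 = 1" "s' 10 = 0" "s' 15 = 100" "s' (100 + j) = y ! j" "s' 18 = Suc j"
      using 2 consts_okD[OF c] s j by (simp_all add: agree_def)
    define s2 where "s2 = s'(rJ := j, rAddr := 100 + j, rSym := y ! j)"
    have a2: "agree ?A s s2" using 2 by (auto simp: s2_def agree_def)
    have k2: "consts_ok s2" by (rule consts_ok_agree[OF c a2]) simp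
    have bnd: "j < W" "100 + j < W" "y ! j < W" using j d y(1) b W_bounds by auto
    have "runs I W forward_prog (\<lambda>t s'. t \<le> 13 + h * 14 \<and> s' rCur = linker_row (?X (Suc j) @ [y ! j]) \<and>
      agree ?F s2 s') s2"
      by (rule runs_forward[OF k2 b _ lX]) (use 2 in \<open>simp_all add: s2_def\<close>)
    then have "runs I W forward_prog (\<lambda>t s'. t \<le> 13 + h * 14 \<and> ?Inv j s') s2"
    proof (rule runs_mono, goal_cases)
      case (1 t s3)
      have "agree ?A s s3" using 1 by (intro agree_trans[OF a2, of _ s3]) auto
      moreover have "s3 18 = j" using 1 by (simp add: agree_def s2_def)
      ultimately show ?case using 1 j X by simp
    qed
    then show ?case using bnd by (auto simp: g s2_def elim!: runs_mono)
  next
    case (3 s')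
    then have "s' 10 = 0" using consts_okD[OF c] by (simp add: agree_def)
    then show ?case using 3 by simp
  qed
  then show ?thesis
    unfolding walk_prog_def using consts_okD[OF c] d y(1) W_bounds
    by (auto simp: s1_def elim!: runs_mono)
qed

definition best :: "str \<Rightarrow> nat \<Rightarrow> nat" where
  "best y n = Max (insert 0 ((\<lambda>d. linker_row (rev (take d y))) ` {m..<n}))"

lemma best_Suc: "m \<le> n \<Longrightarrow> best y (Suc n) = max (linker_row (rev (take n y))) (best y n)"
proof -
  assume "m \<le> n"
  then have "insert 0 ((\<lambda>d. linker_row (rev (take d y))) ` {m..<Suc n}) =
    insert (linker_row (rev (take n y))) (insert 0 ((\<lambda>d. linker_row (rev (take d y))) ` {m..<n}))"
    by (auto simp: less_Suc_eq)
  then show ?thesis unfolding best_def by simp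
qed

lemma runs_search:
  assumes c: "consts_ok s" and y: "length y \<le> k - 1" "set y \<subseteq> {2..\<sigma>}"
    and s: "\<forall>i < length y. s (100 + i) = y ! i" "s rLen = length y" "s rM = m"
  shows "runs I W search_prog (\<lambda>t s'. t \<le> 4 + k * (7 + k * (17 + h * 14)) \<and> s' rV = best y (length y)) s"
proof -
  let ?A = "{rRes, rD, rCur, rAddr, rJ, rSym, rNode, rPos, rChild, rTmp, rShift, rRank}"
  define L where "L = max m (length y)"
  let ?Inv = "\<lambda>n s'. n \<le> L - m \<and> s' rD = L - n \<and> s' rRes = best y (L - n) \<and> agree ?A s s'"
  define s1 where "s1 = s(rRes := 0, rD := m)"
  have best: "best y L = best y (length y)"
    unfolding best_def L_def by (cases "m \<le> length y") (auto simp: max_def)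
  have loop: "runs I W (While (Less rD rLen)
       (walk_prog ;;
        If (Less rRes rCur) (Assign rRes (Arith Add rCur rZero)) Skip ;;
        Assign rD (Arith Add rD rOne)))
    (\<lambda>t s'. t \<le> 1 + (L - m) * Suc (6 + k * (17 + h * 14)) \<and> ?Inv 0 s') s1"
  proof (rule runs_While, goal_cases)
    case 1
    show ?case by (auto simp: s1_def agree_def best_def L_def)
  next
    case (2 n s')
    define d where "d = L - Suc n"
    have d: "m \<le> d" "d < length y" "L - Suc n = d" "L - n = Suc d" using 2 by (auto simp: d_def L_def)
    have a: "agree ?A s s'" using 2 by simp
    have k': "consts_ok s'" by (rule consts_ok_agree[OF c a]) simp
    have s': "s' rD = d" "s' rRes = best y d" "\<forall>i < length y. s' (100 + i) = y ! i" "s' rLen = length y"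
      using 2 s d by (simp_all add: agree_def)
    have "runs I W (walk_prog ;;
        If (Less rRes rCur) (Assign rRes (Arith Add rCur rZero)) Skip ;;
        Assign rD (Arith Add rD rOne)) (\<lambda>t s'. t \<le> 6 + k * (17 + h * 14) \<and> ?Inv n s') s'"
      unfolding runs_Seq[of _ _ walk_prog]
    proof (rule runs_mono[OF runs_walk[OF k' s'(1) d(2) y s'(3)]], goal_cases)
      case (1 t s2)
      have a2: "agree ?A s s2" using 1 by (intro agree_trans[OF a, of _ s2]) auto
      have g: "s2 8 = 1" "s2 10 = 0" "s2 26 = best y d" "s2 17 = d"
        using 1 s' consts_okD[OF k'] by (simp_all add: agree_def)
      have "linker_row (rev (take d y)) \<le> N" using d(2) y(1) by (intro linker_row_le) simp
      then have bnd: "linker_row (rev (take d y)) < W" "d + 1 < W" using W_bounds d(2) y(1) by auto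
      have "d * (17 + h * 14) \<le> k * (17 + h * 14)" using d(2) y(1) by (intro mult_right_mono) auto
      then have t: "t \<le> 3 + k * (17 + h * 14)" using 1 by linarith
      have n: "n \<le> L - m" using 2 by simp
      show ?case using 1 t n a2 bnd
        by (auto simp: g d(4) best_Suc[OF d(1)] max_def simp del: mult_Suc_right intro!: agree_upd)
    qed
    then show ?case using s' d by simp
  next
    case (3 s')
    then show ?case using s by (auto simp: agree_def L_def)
  qed
  have bW: "best y (length y) < W"
  proof -
    have "linker_row (rev (take d y)) \<le> N" if "d < length y" for d
      using that y(1) by (intro linker_row_le) simp
    then have "best y (length y) \<le> N" unfolding best_def by (subst Max_le_iff) auto
    then show ?thesis using W_bounds by simp
  qed
  have L: "L - m \<le> k" using y(1) by (auto simp: L_def)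
  have "(L - m) * Suc (6 + k * (17 + h * 14)) \<le> k * (7 + k * (17 + h * 14))"
    using mult_right_mono[OF L, of "7 + k * (17 + h * 14)"] by simp
  then have T: "t \<le> 1 + k * (7 + k * (17 + h * 14))" if "t \<le> 1 + (L - m) * Suc (6 + k * (17 + h * 14))" for t
    using that by linarith
  have "runs I W (While (Less rD rLen)
       (walk_prog ;;
        If (Less rRes rCur) (Assign rRes (Arith Add rCur rZero)) Skip ;;
        Assign rD (Arith Add rD rOne)) ;;
     Assign rV (Arith Add rRes rZero))
     (\<lambda>t s'. t \<le> 2 + k * (7 + k * (17 + h * 14)) \<and> s' rV = best y (length y)) s1"
    unfolding runs_Seq[of _ _ "While _ _"]
  proof (rule runs_mono[OF loop], goal_cases)
    case (1 t s')
    have "s' 10 = 0" using 1 consts_okD[OF c] by (simp add: agree_def)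
    moreover have "s' 26 = best y (length y)" using 1 best by simp
    ultimately show ?case using T[of t] 1 bW by simp
  qed
  then show ?thesis
    unfolding search_prog_def using consts_okD[OF c] s W_bounds
    by (simp add: s1_def)
qed

lemma runs_init:
  assumes s: "s rHeight = h" "s rZero = 0" "s rSigma = \<sigma>"
  shows "runs I W init_prog (\<lambda>t s'. t \<le> 6 + h * 3 \<and> consts_ok s' \<and> (\<forall>a \<le> 2. s' a = s a)) s"
proof -
  let ?Inv = "\<lambda>n s'. n \<le> h \<and> s' rCount = n \<and> s' rPow = 2 ^ (h - n) \<and> s' rOne = 1 \<and> s' rTwo = 2 \<and>
    s' rZero = 0 \<and> s' rBase = 100 \<and> s' rSigma = \<sigma> \<and> (\<forall>a \<le> 2. s' a = s a)"
  define s1 where "s1 = s(rOne := 1, rTwo := 2, rBase := 100, rPow := 1, rCount := h)"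
  have "runs I W (While (Less rZero rCount)
       (Assign rPow (Arith Mul rPow rTwo) ;; Assign rCount (Arith Sub rCount rOne)))
      (\<lambda>t s'. t \<le> 1 + h * Suc 2 \<and> ?Inv 0 s') s1"
  proof (rule runs_While[where Inv = ?Inv], goal_cases)
    case 1
    show ?case using s by (auto simp: s1_def)
  next
    case (2 n s')
    have "(2::nat) ^ (h - n) < W" by (rule powW) simp
    moreover have "(2::nat) ^ (h - n) = 2 ^ (h - Suc n) * 2" using 2
      by (metis Suc_diff_Suc Suc_le_lessD power_Suc2)
    moreover have "n < W" using 2 powW[of h] less_exp[of h] by linarith
    ultimately show ?case using 2 by simp
  next
    case (3 s')
    then show ?case by simp
  qed
  then have "runs I W (While (Less rZero rCount)
       (Assign rPow (Arith Mul rPow rTwo) ;; Assign rCount (Arith Sub rCount rOne)))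
      (\<lambda>t s'. t \<le> 1 + h * 3 \<and> consts_ok s' \<and> (\<forall>a \<le> 2. s' a = s a)) s1"
    by (rule runs_mono) (auto simp: consts_ok_def)
  moreover have "h < W" using powW[of h] less_exp[of h] by linarith
  ultimately show ?thesis
    unfolding init_prog_def using s W_bounds
    by (simp add: s1_def fun_upd_twist)
qed

lemma llabel_node:
  assumes "v \<in> {1..N}"
  shows "set (llabel (rw v)) \<subseteq> {2..\<sigma>}" "length (llabel (rw v)) \<le> k - 1"
proof -
  show "set (llabel (rw v)) \<subseteq> {2..\<sigma>}"
  proof (cases "rw v \<in> solid_nodes k S")
    case True
    then show ?thesis using solid_symbols[OF True] llabel_solid by simp
  next
    case False
    then obtain X where "rw v = linker k X" "is_prefix X"
      using row_node[OF assms] by (auto simp: nodes_def linker_nodes_iff)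
    then show ?thesis using is_prefix_symbols llabel_linker by simp
  qed
  show "length (llabel (rw v)) \<le> k - 1"
    using length_node[OF row_node[OF assms]] unfolding llabel_def by (metis length_dropWhile_le)
qed

lemma nextcontained_eq_best:
  assumes v: "v \<in> {1..N}"
  defines "y \<equiv> rev (llabel (rw v))"
  shows "nextcontained k m S v = best y (length y)"
proof -
  let ?f = "\<lambda>d. linker_row (rev (take d y))"
  let ?D = "{d \<in> {m..<length y}. is_prefix (rev (take d y))}"
  have len: "length y \<le> k - 1" using llabel_node(2)[OF v] by (simp add: y_def)
  have CL: "contained_linkers k m S v = ?f ` ?D"
  proof (intro equalityI subsetI)
    fix i assume i: "i \<in> contained_linkers k m S v"
    then obtain X where X: "rw i = linker k X" "length X < k - 1" "is_prefix X"
      by (auto simp: contained_linkers_def linker_nodes_iff)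
    have l: "llabel (rw i) = X" using X llabel_linker[OF is_prefix_symbols] by simp
    have suf: "strict_suffix X (rev y)" "m \<le> length X" "i \<in> {1..N}"
      using i l by (auto simp: contained_linkers_def y_def)
    then obtain Z where Z: "rev y = Z @ X" "Z \<noteq> []" by (auto simp: strict_suffix_def suffix_def)
    have "y = rev X @ rev Z" using arg_cong[OF Z(1), of rev] by simp
    then have "X = rev (take (length X) y)" "length X < length y" using Z(2) by auto
    moreover have "i = linker_row X" using linker_row_eqI[OF X(3) suf(3) X(1)] by simp
    ultimately show "i \<in> ?f ` ?D" using X(3) suf(2) by force
  next
    fix i assume "i \<in> ?f ` ?D"
    then obtain d where d: "i = ?f d" "m \<le> d" "d < length y" "is_prefix (rev (take d y))" by auto
    let ?X = "rev (take d y)"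
    have lX: "length ?X < k - 1" using d(3) len by simp
    note lr = linker_row[OF d(4) lX]
    have l: "llabel (rw i) = ?X" using lr d(1) llabel_linker[OF is_prefix_symbols[OF d(4)]] by simp
    have "rev y = rev (drop d y) @ ?X" by (metis append_take_drop_id rev_append)
    then have "suffix ?X (rev y)" by (auto simp: suffix_def)
    moreover have "?X \<noteq> rev y" using d(3) by (metis length_rev length_take less_irrefl min.absorb4)
    ultimately have ss: "strict_suffix ?X (llabel (rw v))" "suffix ?X (llabel (rw v))"
      by (auto simp: y_def strict_suffix_def)
    have "i \<noteq> v" using ss(1) l by (auto simp: strict_suffix_def)
    moreover have "rw i \<in> linker_nodes k S" using lr d(1,4) lX linker_in_linker_nodes by simp
    ultimately show "i \<in> contained_linkers k m S v"
      using lr d ss l by (auto simp: contained_linkers_def contained_def)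
  qed
  have "?f d \<in> insert 0 (?f ` ?D)" if "d \<in> {m..<length y}" for d
    using that by (cases "is_prefix (rev (take d y))") (auto simp: linker_row_def)
  then have "?f ` {m..<length y} \<subseteq> insert 0 (?f ` ?D)" by (rule image_subsetI)
  moreover have "?f ` ?D \<subseteq> ?f ` {m..<length y}" by (rule image_mono) auto
  moreover have "insert x U = insert x V" if "U \<subseteq> insert x V" "V \<subseteq> U" for x and U V :: "nat set"
    using that by blast
  ultimately have eq: "insert 0 (?f ` {m..<length y}) = insert 0 (?f ` ?D)" by simp
  show ?thesis
  proof (cases "?D = {}")
    case True
    then show ?thesis unfolding nextcontained_def CL best_def eq True by simp
  next
    case False
    then show ?thesis unfolding nextcontained_def CL best_def eq
      by (subst Max_insert) auto
  qed
qed

lemma runs_nextcontained: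
  assumes v: "v \<in> {1..N}"
    and s: "s 0 = v" "s 1 = m" "s 2 = k" "s 3 = \<sigma>" "s 6 = h" "s 10 = 0"
  shows "runs I W nextcontained_prog (\<lambda>t s'. t \<le> 60 * k ^ 2 * (h + 1) \<and> s' 0 = nextcontained k m S v) s"
proof -
  let ?y = "rev (llabel (rw v))"
  have search: "runs I W search_prog (\<lambda>t s'. t \<le> 4 + k * (7 + k * (17 + h * 14)) \<and> s' 0 = nextcontained k m S v) s2"
    if "s2 rLen = length (llabel (rw v))" "\<forall>i < length (llabel (rw v)). s2 (100 + i) = ?y ! i"
      "consts_ok s2" "s2 rM = m" for s2
    unfolding nextcontained_eq_best[OF v]
    by (rule runs_search) (use that llabel_node[OF v] in simp_all)
  have label: "runs I W (label_prog ;; search_prog)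
    (\<lambda>t s'. t \<le> 8 + k * (16 + h * 13) + k * (7 + k * (17 + h * 14)) \<and> s' 0 = nextcontained k m S v) s1"
    if "consts_ok s1" "\<forall>a \<le> 2. s1 a = s a" for s1
    unfolding runs_Seq[of _ _ label_prog]
  proof (rule runs_mono[OF runs_label[OF that(1) v]], goal_cases)
    case (3 t s2)
    then show ?case by (intro runs_mono[OF search]) (use that(2) s in auto)
  qed (use that(2) s in auto)
  have "runs I W nextcontained_prog
    (\<lambda>t s'. t \<le> 14 + h * 3 + k * (16 + h * 13) + k * (7 + k * (17 + h * 14)) \<and> s' 0 = nextcontained k m S v) s"
    unfolding nextcontained_prog_def runs_Seq[of _ _ init_prog]
  proof (rule runs_mono[OF runs_init], goal_cases)
    case (4 t s1)
    then show ?case by (intro runs_mono[OF label]) auto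
  qed (use s in auto)
  moreover have "14 + h * 3 + k * (16 + h * 13) + k * (7 + k * (17 + h * 14)) \<le> 60 * k ^ 2 * (h + 1)"
  proof -
    have k: "1 \<le> k ^ 2" "k \<le> k ^ 2" using k_ge by (auto simp: power2_eq_square)
    have hk: "h \<le> h * k ^ 2" "h * k \<le> h * k ^ 2" using k by (metis mult.right_neutral mult_le_mono2)+
    have "14 + h * 3 + k * (16 + h * 13) + k * (7 + k * (17 + h * 14)) =
      14 + 3 * h + 23 * k + 13 * (h * k) + 17 * k ^ 2 + 14 * (h * k ^ 2)"
      by (simp add: algebra_simps power2_eq_square)
    also have "\<dots> \<le> 60 * k ^ 2 + 60 * (h * k ^ 2)" using k hk by linarith
    also have "\<dots> = 60 * k ^ 2 * (h + 1)" by (simp add: algebra_simps)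
    finally show ?thesis .
  qed
  ultimately show ?thesis by (elim runs_mono) auto
qed

end

theorem theorem2:
  shows "\<exists>(p :: com) (c :: real) (d :: nat).
    \<forall>(\<sigma> :: nat) (\<pi> :: nat \<Rightarrow> nat) (z :: nat) (R :: str set) (k :: nat) (m :: nat) (v :: nat) (W :: nat).
      2 \<le> \<sigma> \<longrightarrow> complement_map \<sigma> \<pi> \<longrightarrow> read_set \<sigma> z R \<longrightarrow> 3 \<le> k \<longrightarrow>
      v \<in> {1..num_rows k (rc_closure \<pi> R)} \<longrightarrow>
      d * sum_list (input_list \<sigma> k m (rc_closure \<pi> R) v) \<le> W \<longrightarrow>
      (\<exists>t s. exec (vo_boss_index \<sigma> k (rc_closure \<pi> R)) W p
               (initial_mem (input_list \<sigma> k m (rc_closure \<pi> R) v)) t s \<and>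
             s 0 = nextcontained k m (rc_closure \<pi> R) v \<and>
             real t \<le> c * real k ^ 2 * log 2 (real \<sigma>))"
proof (rule exI[of _ nextcontained_prog], rule exI[of _ 240], rule exI[of _ 100], intro allI impI)
  fix \<sigma> :: nat and \<pi> :: "nat \<Rightarrow> nat" and z :: nat and R :: "str set" and k m v W :: nat
  assume \<sigma>: "2 \<le> \<sigma>" and \<pi>: "complement_map \<sigma> \<pi>" and R: "read_set \<sigma> z R" and k: "3 \<le> k"
    and v: "v \<in> {1..num_rows k (rc_closure \<pi> R)}"
    and W: "100 * sum_list (input_list \<sigma> k m (rc_closure \<pi> R) v) \<le> W"
  define S where "S = rc_closure \<pi> R"
  have finS: "finite S" using R by (simp add: S_def rc_closure_def read_set_def)
  have sym: "set s \<subseteq> {2..\<sigma>}" if "s \<in> S" for s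
    using that R \<pi> unfolding S_def rc_closure_def read_set_def complement_map_def revcomp_def by fastforce
  have ne: "S \<noteq> {}"
  proof
    assume "S = {}"
    then have "nodes k S = {}" by (auto simp: nodes_def solid_nodes_def linker_nodes_def)
    then have "num_rows k S = 0" by (simp add: num_rows_def boss_matrix_def)
    then show False using v by (simp add: S_def)
  qed
  interpret boss_machine \<sigma> k S m W
    by unfold_locales (use finS sym ne k \<sigma> W in \<open>simp_all add: input_list_def S_def\<close>)
  let ?s = "initial_mem (input_list \<sigma> k m S v)"
  have "runs I W nextcontained_prog (\<lambda>t s'. t \<le> 60 * k ^ 2 * (h + 1) \<and> s' 0 = nextcontained k m S v) ?s"
    by (rule runs_nextcontained) (use v in \<open>simp_all add: initial_mem_def input_list_def S_def\<close>)
  then obtain t s where t: "exec I W nextcontained_prog ?s t s" "t \<le> 60 * k ^ 2 * (h + 1)"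
    "s 0 = nextcontained k m S v"
    by (auto simp: runs_def)
  have "(2::nat) ^ h < 2 * (2 * \<sigma> + 1)"
    unfolding E_height_def by (rule two_power_ceillog2_gt) simp
  moreover have "even ((2::nat) ^ h)" using two_sigma_less \<sigma> by (cases h) auto
  ultimately have "(2::nat) ^ h \<le> 4 * \<sigma>" by (cases "2 ^ h = 4 * \<sigma> + 1") auto
  then have "real (2 ^ h) \<le> real (4 * \<sigma>)" by (rule of_nat_mono)
  then have "log 2 (2 ^ h) \<le> log 2 (4 * real \<sigma>)" using \<sigma> by (intro log_mono) auto
  also have "\<dots> = 2 + log 2 (real \<sigma>)"
    using \<sigma> log_pow_cancel[of 2 2] by (simp add: log_mult)
  finally have "real h \<le> 2 + log 2 (real \<sigma>)" by (simp add: log_nat_power)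
  moreover have "1 \<le> log 2 (real \<sigma>)" using \<sigma> by (simp add: le_log_iff)
  ultimately have hl: "real h + 1 \<le> 4 * log 2 (real \<sigma>)" by linarith
  have "real t \<le> real (60 * k ^ 2 * (h + 1))" using t(2) by (rule of_nat_mono)
  also have "\<dots> = 60 * real k ^ 2 * (real h + 1)" by (simp add: algebra_simps)
  also have "\<dots> \<le> 60 * real k ^ 2 * (4 * log 2 (real \<sigma>))" using hl by (intro mult_left_mono) auto
  finally have "real t \<le> 240 * real k ^ 2 * log 2 (real \<sigma>)" by simp
  then show "\<exists>t s. exec (vo_boss_index \<sigma> k (rc_closure \<pi> R)) W nextcontained_prog
       (initial_mem (input_list \<sigma> k m (rc_closure \<pi> R) v)) t s \<and>
     s 0 = nextcontained k m (rc_closure \<pi> R) v \<and> real t \<le> 240 * real k ^ 2 * log 2 (real \<sigma>)"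
    using t unfolding S_def by blast
qed

end
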